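(* $\mathsf{CatBaseComp}$ is a type-category, i.e. a $(\mathrm{fam},\Sigma)$-category with a terminal object.
   Context: A base of computability $B$ in a category $\mathscr C$ is a family $(B(a))_{a\in\mathscr C_0}$, where each $B(a)$ is a subclass of the class $\mathrm{Mon}(-,a)$ of monomorphisms with codomain $a$, such that: (Base1) $1_a\in B(a)$ for every object $a$; (Base2) for all objects $a,b$, all $i\colon s\to a$ in $B(a)$, all $j\colon t\to b$ in $B(b)$, and all $f\colon s\to b$, there is a pullback of $j$ along $f$, with projection $f^*j\colon j^*(s)\to s$, such that $i\circ f^*j\in B(a)$. If $C$, $D$ are bases of computability in $\mathscr C$, $\mathscr D$, a computability transfer $F\colon(\mathscr C,C)\to(\mathscr D,D)$ is a functor $F\colon\mathscr C\to\mathscr D$ such that $F(i)\in D(F(a))$ for all objects $a$ and all $i\in C(a)$, and $F$ preserves all pullbacks occurring in (Base2) (i.e. pullbacks of arrows $j\in C(b)$ along arbitrary arrows $f\colon s\to b$). $\mathsf{CatBaseComp}$ is the category of categories with a base of computability and computability transfers. A fam-category is a category $\mathscr K$ with a collection $\mathrm{fHom}(c)$ of family arrows for each object $c$, and composition operations $\mathrm{fHom}(d)\times\mathrm{Hom}(c,d)\to\mathrm{fHom}(c)$, $(\lambda,f)\mapsto\lambda\circ f$, such that $\lambda\circ1_c=\lambda$ and $\lambda\circ(g\circ f)=(\lambda\circ g)\circ f$. A $(\mathrm{fam},\Sigma)$-category is a fam-category $\mathscr K$ such that for all objects $a,b$, all $\lambda\in\mathrm{fHom}(a)$ and all $f\in\mathrm{Hom}(b,a)$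 there are an object $\sum_a\lambda$ (Sigma-object) and arrows $\mathrm{pr}_1^{a,\lambda}\colon\sum_a\lambda\to a$ and $\Sigma_\lambda f\colon\sum_b(\lambda\circ f)\to\sum_a\lambda$ such that the square with top $\Sigma_\lambda f$, left side $\mathrm{pr}_1^{b,\lambda\circ f}$, right side $\mathrm{pr}_1^{a,\lambda}$ and bottom $f$ is a pullback, and such that $\Sigma_\lambda1_a=1_{\sum_a\lambda}$ and $\Sigma_\lambda(f\circ g)=(\Sigma_\lambda f)\circ\Sigma_{\lambda\circ f}g$ for all $f\colon b\to a$, $g\colon c\to b$. A type-category is a $(\mathrm{fam},\Sigma)$-category with a terminal object. The structure on $\mathsf{CatBaseComp}$ in question: $\mathrm{fHom}(\mathscr C,C)$ is the collection of all functors $P\colon\mathscr C^{\mathrm{op}}\to\mathsf{Sets}$, and composition with a computability transfer $F\colon(\mathscr D,D)\to(\mathscr C,C)$ is composition of the underlying functors, $P\circ F\colon\mathscr D^{\mathrm{op}}\to\mathsf{Sets}$. The Sigma-object of $P\in\mathrm{fHom}(\mathscr C,C)$ is $\big(\sum_{\mathscr C}P,(\mathrm{pr}_1^P)^{-1}(C)\big)$, where $\sum_{\mathscr C}P$ is the category of elements of $P$ (objects $(c,x)$ with $x\in P(c)$), $\mathrm{pr}_1^P\colon\sum_{\mathscr C}P\to\mathscr C$ is the projection (a Grothendieck fibration), and $(\mathrm{pr}_1^P)^{-1}(C)(c,x)$ is the class of monos with codomain $(c,x)$ that are $\mathrm{pr}_1^P$-cartesian lifts of some $j\in C(c)$; and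 $\Sigma_PF$ is the induced functor on categories of elements $(d,x)\mapsto(F(d),x)$. *)

theory Defs
  imports Main "HOL-Library.FuncSet"
begin

section \<open>Categories and functors\<close>

text \<open>All operations are required to be \<open>undefined\<close> off their domain of definition, so that
  HOL equality of the records is equality of categories, respectively of functors.\<close>

record ('o, 'm) precategory =
  Obj :: "'o set"
  Arr :: "'m set"
  Dom :: "'m \<Rightarrow> 'o"
  Cod :: "'m \<Rightarrow> 'o"
  Ide :: "'o \<Rightarrow> 'm"
  Comp :: "'m \<Rightarrow> 'm \<Rightarrow> 'm"  (infixl "\<cdot>\<index>" 70)

definition hom :: "('o, 'm) precategory \<Rightarrow> 'o \<Rightarrow> 'o \<Rightarrow> 'm set" where
  "hom C a b = {f \<in> Arr C. Dom C f = a \<and> Cod C f = b}"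

locale category =
  fixes C :: "('o, 'm) precategory" (structure)
  assumes Dom_type: "Dom C \<in> Arr C \<rightarrow>\<^sub>E Obj C"
    and Cod_type: "Cod C \<in> Arr C \<rightarrow>\<^sub>E Obj C"
    and Ide_ext: "Ide C \<in> extensional (Obj C)"
    and Ide_hom: "a \<in> Obj C \<Longrightarrow> Ide C a \<in> hom C a a"
    and Comp_ext: "\<not> (g \<in> Arr C \<and> f \<in> Arr C \<and> Dom C g = Cod C f) \<Longrightarrow> g \<cdot> f = undefined"
    and Comp_hom: "\<lbrakk>f \<in> hom C a b; g \<in> hom C b c\<rbrakk> \<Longrightarrow> g \<cdot> f \<in> hom C a c"
    and Comp_Ide_right: "f \<in> hom C a b \<Longrightarrow> f \<cdot> Ide C a = f"
    and Comp_Ide_left: "f \<in> hom C a b \<Longrightarrow> Ide C b \<cdot> f = f"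
    and Comp_assoc: "\<lbrakk>f \<in> hom C a b; g \<in> hom C b c; h \<in> hom C c d\<rbrakk>
        \<Longrightarrow> (h \<cdot> g) \<cdot> f = h \<cdot> (g \<cdot> f)"

definition opposite :: "('o, 'm) precategory \<Rightarrow> ('o, 'm) precategory" where
  "opposite C = \<lparr>Obj = Obj C, Arr = Arr C, Dom = Cod C, Cod = Dom C, Ide = Ide C,
     Comp = (\<lambda>g f. f \<cdot>\<^bsub>C\<^esub> g)\<rparr>"

definition Mon :: "('o, 'm) precategory \<Rightarrow> 'o \<Rightarrow> 'm set" where
  "Mon C a = {m \<in> Arr C. Cod C m = a \<and>
     (\<forall>x. \<forall>u \<in> hom C x (Dom C m). \<forall>v \<in> hom C x (Dom C m). m \<cdot>\<^bsub>C\<^esub> u = m \<cdot>\<^bsub>C\<^esub> v \<longrightarrow> u = v)}"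

definition terminal :: "('o, 'm) precategory \<Rightarrow> 'o \<Rightarrow> bool" where
  "terminal C t \<longleftrightarrow> t \<in> Obj C \<and> (\<forall>a \<in> Obj C. \<exists>!f. f \<in> hom C a t)"

text \<open>The square with left side \<open>p\<close>, top \<open>q\<close>, right side \<open>j\<close> and bottom \<open>f\<close> is a pullback;
  thus \<open>p\<close> is the pullback of \<open>j\<close> along \<open>f\<close>.\<close>

definition pullback :: "('o, 'm) precategory \<Rightarrow> 'm \<Rightarrow> 'm \<Rightarrow> 'm \<Rightarrow> 'm \<Rightarrow> bool" where
  "pullback C f j p q \<longleftrightarrow>
     f \<in> Arr C \<and> j \<in> Arr C \<and> Cod C f = Cod C j \<and>
     p \<in> hom C (Dom C p) (Dom C f) \<and> q \<in> hom C (Dom C p) (Dom C j) \<and>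
     f \<cdot>\<^bsub>C\<^esub> p = j \<cdot>\<^bsub>C\<^esub> q \<and>
     (\<forall>x. \<forall>u \<in> hom C x (Dom C f). \<forall>v \<in> hom C x (Dom C j). f \<cdot>\<^bsub>C\<^esub> u = j \<cdot>\<^bsub>C\<^esub> v \<longrightarrow>
        (\<exists>!k. k \<in> hom C x (Dom C p) \<and> p \<cdot>\<^bsub>C\<^esub> k = u \<and> q \<cdot>\<^bsub>C\<^esub> k = v))"

record ('o, 'm, 'p, 'n) functor_map =
  OMap :: "'o \<Rightarrow> 'p"
  AMap :: "'m \<Rightarrow> 'n"

locale cat_functor = source: category C + target: category D
  for C :: "('o, 'm) precategory" and D :: "('p, 'n) precategory" +
  fixes F :: "('o, 'm, 'p, 'n) functor_map"
  assumes OMap_type: "OMap F \<in> Obj C \<rightarrow>\<^sub>E Obj D"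
    and AMap_ext: "AMap F \<in> extensional (Arr C)"
    and AMap_hom: "f \<in> hom C a b \<Longrightarrow> AMap F f \<in> hom D (OMap F a) (OMap F b)"
    and AMap_Ide: "a \<in> Obj C \<Longrightarrow> AMap F (Ide C a) = Ide D (OMap F a)"
    and AMap_Comp: "\<lbrakk>f \<in> hom C a b; g \<in> hom C b c\<rbrakk>
        \<Longrightarrow> AMap F (g \<cdot>\<^bsub>C\<^esub> f) = AMap F g \<cdot>\<^bsub>D\<^esub> AMap F f"

definition functor_id :: "('o, 'm) precategory \<Rightarrow> ('o, 'm, 'o, 'm) functor_map" where
  "functor_id C = \<lparr>OMap = (\<lambda>a\<in>Obj C. a), AMap = (\<lambda>f\<in>Arr C. f)\<rparr>"

text \<open>\<open>C\<close> is the source of \<open>F\<close>. Since a functor \<open>C \<rightarrow> D\<close> and its opposite have the same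
  underlying maps, this also gives the composite of \<open>F\<close> with a presheaf on \<open>D\<close>.\<close>

definition functor_comp ::
    "('o, 'm) precategory \<Rightarrow> ('p, 'n, 'q, 'r) functor_map \<Rightarrow> ('o, 'm, 'p, 'n) functor_map
      \<Rightarrow> ('o, 'm, 'q, 'r) functor_map" where
  "functor_comp C G F =
     \<lparr>OMap = (\<lambda>a\<in>Obj C. OMap G (OMap F a)), AMap = (\<lambda>f\<in>Arr C. AMap G (AMap F f))\<rparr>"

definition cartesian ::
    "('o, 'm) precategory \<Rightarrow> ('p, 'n) precategory \<Rightarrow> ('o, 'm, 'p, 'n) functor_map \<Rightarrow> 'm \<Rightarrow> bool" where
  "cartesian E C p m \<longleftrightarrow> m \<in> Arr E \<and>
     (\<forall>x. \<forall>g \<in> hom E x (Cod E m). \<forall>h \<in> hom C (OMap p x) (OMap p (Dom E m)).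
        AMap p m \<cdot>\<^bsub>C\<^esub> h = AMap p g \<longrightarrow>
        (\<exists>!k. k \<in> hom E x (Dom E m) \<and> AMap p k = h \<and> m \<cdot>\<^bsub>E\<^esub> k = g))"


section \<open>Bases of computability\<close>

locale base_of_computability = category C
  for C :: "('o, 'm) precategory" (structure) +
  fixes B :: "'o \<Rightarrow> 'm set"
  assumes Base_ext: "B \<in> extensional (Obj C)"
    and Base_Mon: "a \<in> Obj C \<Longrightarrow> B a \<subseteq> Mon C a"
    and Base1: "a \<in> Obj C \<Longrightarrow> Ide C a \<in> B a"
    and Base2: "\<lbrakk>a \<in> Obj C; b \<in> Obj C; i \<in> B a; j \<in> B b; f \<in> hom C (Dom C i) b\<rbrakk>
        \<Longrightarrow> \<exists>p q. pullback C f j p q \<and> i \<cdot> p \<in> B a"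

locale computability_transfer = cat_functor C D F +
    source: base_of_computability C B + target: base_of_computability D B'
  for C :: "('o, 'm) precategory" and B and D :: "('p, 'n) precategory" and B' and F +
  assumes transfer_base: "\<lbrakk>a \<in> Obj C; i \<in> B a\<rbrakk> \<Longrightarrow> AMap F i \<in> B' (OMap F a)"
    and transfer_pullback: "\<lbrakk>b \<in> Obj C; j \<in> B b; f \<in> hom C s b; pullback C f j p q\<rbrakk>
        \<Longrightarrow> pullback D (AMap F f) (AMap F j) (AMap F p) (AMap F q)"

definition preimage_base ::
    "('o, 'm) precategory \<Rightarrow> ('p, 'n) precategory \<Rightarrow> ('o, 'm, 'p, 'n) functor_map
      \<Rightarrow> ('p \<Rightarrow> 'n set) \<Rightarrow> 'o \<Rightarrow> 'm set" where
  "preimage_base E C p B =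
     (\<lambda>e\<in>Obj E. {m \<in> Mon E e. cartesian E C p m \<and> AMap p m \<in> B (OMap p e)})"


section \<open>Type-categories\<close>

text \<open>An arrow of a \<open>precategory\<close> determines its domain and codomain, so \<open>fcomp\<close> and \<open>Sarr\<close>
  need not take these as arguments.\<close>

locale fam_category = category K
  for K :: "('o, 'm) precategory" (structure) +
  fixes fHom :: "'o \<Rightarrow> 'l set"
    and fcomp :: "'l \<Rightarrow> 'm \<Rightarrow> 'l"  (infixl "\<star>" 70)
  assumes fcomp_fHom: "\<lbrakk>c \<in> Obj K; d \<in> Obj K; l \<in> fHom d; f \<in> hom K c d\<rbrakk> \<Longrightarrow> l \<star> f \<in> fHom c"
    and fcomp_Ide: "\<lbrakk>c \<in> Obj K; l \<in> fHom c\<rbrakk> \<Longrightarrow> l \<star> Ide K c = l"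
    and fcomp_Comp: "\<lbrakk>l \<in> fHom e; f \<in> hom K c d; g \<in> hom K d e\<rbrakk>
        \<Longrightarrow> l \<star> (g \<cdot> f) = (l \<star> g) \<star> f"

locale fam_Sigma_category = fam_category K fHom fcomp
  for K :: "('o, 'm) precategory" (structure)
    and fHom :: "'o \<Rightarrow> 'l set"
    and fcomp :: "'l \<Rightarrow> 'm \<Rightarrow> 'l"  (infixl "\<star>" 70) +
  fixes Sigma_obj :: "'o \<Rightarrow> 'l \<Rightarrow> 'o"
    and pr1 :: "'o \<Rightarrow> 'l \<Rightarrow> 'm"
    and Sarr :: "'l \<Rightarrow> 'm \<Rightarrow> 'm"
  assumes Sigma_obj: "\<lbrakk>a \<in> Obj K; l \<in> fHom a\<rbrakk> \<Longrightarrow> Sigma_obj a l \<in> Obj K"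
    and pr1_hom: "\<lbrakk>a \<in> Obj K; l \<in> fHom a\<rbrakk> \<Longrightarrow> pr1 a l \<in> hom K (Sigma_obj a l) a"
    and Sarr_hom: "\<lbrakk>a \<in> Obj K; b \<in> Obj K; l \<in> fHom a; f \<in> hom K b a\<rbrakk>
        \<Longrightarrow> Sarr l f \<in> hom K (Sigma_obj b (l \<star> f)) (Sigma_obj a l)"
    and Sigma_pullback: "\<lbrakk>a \<in> Obj K; b \<in> Obj K; l \<in> fHom a; f \<in> hom K b a\<rbrakk>
        \<Longrightarrow> pullback K f (pr1 a l) (pr1 b (l \<star> f)) (Sarr l f)"
    and Sarr_Ide: "\<lbrakk>a \<in> Obj K; l \<in> fHom a\<rbrakk> \<Longrightarrow> Sarr l (Ide K a) = Ide K (Sigma_obj a l)"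
    and Sarr_Comp: "\<lbrakk>l \<in> fHom a; f \<in> hom K b a; g \<in> hom K c b\<rbrakk>
        \<Longrightarrow> Sarr l (f \<cdot> g) = Sarr l f \<cdot> Sarr (l \<star> f) g"

locale type_category = fam_Sigma_category +
  assumes terminal_ex: "\<exists>t. terminal K t"


section \<open>Presheaves and categories of elements\<close>

text \<open>HOL has no type of all categories. We work over a universe closed under pairing, freely
  generated by an arbitrary type \<open>'a\<close> of atoms. Categories have as objects and arrows arbitrary
  collections of members of the universe; these are closed under categories of elements.\<close>

datatype 'a univ = Atom 'a | UPair (ufst: "'a univ") (usnd: "'a univ")

text \<open>The category of sets belonging to a given collection \<open>S\<close> of subsets of the universe, and all
  functions between them. With \<open>S = UNIV\<close>, sets are of the same size as the categories in question;
  with a smaller \<open>S\<close>, one gets \<open>S\<close>-small sets and possibly large categories. An arrow is a triple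
  of domain, codomain and function.\<close>

type_synonym 'u set_arrow = "'u set \<times> 'u set \<times> ('u \<Rightarrow> 'u)"

definition Sets :: "'u set set \<Rightarrow> ('u set, 'u set_arrow) precategory" where
  "Sets S = (let A = {(X, Y, h). X \<in> S \<and> Y \<in> S \<and> h \<in> X \<rightarrow>\<^sub>E Y} in
     \<lparr>Obj = S, Arr = A,
      Dom = (\<lambda>m\<in>A. fst m), Cod = (\<lambda>m\<in>A. fst (snd m)),
      Ide = (\<lambda>X\<in>S. (X, X, \<lambda>x\<in>X. x)),
      Comp = (\<lambda>m' m. if m' \<in> A \<and> m \<in> A \<and> fst m' = fst (snd m)
        then (fst m, fst (snd m'), compose (fst m) (snd (snd m')) (snd (snd m)))
        else undefined)\<rparr>)"

type_synonym 'a ucat = "('a univ, 'a univ) precategory"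
type_synonym 'a ufun = "('a univ, 'a univ, 'a univ, 'a univ) functor_map"
type_synonym 'a presheaf = "('a univ, 'a univ, 'a univ set, 'a univ set_arrow) functor_map"

definition presheaves :: "'a univ set set \<Rightarrow> 'a ucat \<Rightarrow> 'a presheaf set" where
  "presheaves S C = {P. cat_functor (opposite C) (Sets S) P}"

definition pact :: "'a presheaf \<Rightarrow> 'a univ \<Rightarrow> 'a univ \<Rightarrow> 'a univ" where
  "pact P f = snd (snd (AMap P f))"

text \<open>An arrow \<open>(c, x) \<rightarrow> (d, y)\<close> of the category of elements is an arrow \<open>f : c \<rightarrow> d\<close> with
  \<open>P(f)(y) = x\<close>. It is encoded as \<open>earr (c, x) f (d, y)\<close>.\<close>

definition earr :: "'a univ \<Rightarrow> 'a univ \<Rightarrow> 'a univ \<Rightarrow> 'a univ" where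
  "earr e f e' = UPair e (UPair f e')"

definition earr_dom :: "'a univ \<Rightarrow> 'a univ" where "earr_dom m = ufst m"
definition earr_base :: "'a univ \<Rightarrow> 'a univ" where "earr_base m = ufst (usnd m)"
definition earr_cod :: "'a univ \<Rightarrow> 'a univ" where "earr_cod m = usnd (usnd m)"

definition elements_obj :: "'a ucat \<Rightarrow> 'a presheaf \<Rightarrow> 'a univ set" where
  "elements_obj C P = {UPair c x | c x. c \<in> Obj C \<and> x \<in> OMap P c}"

definition elements_arr :: "'a ucat \<Rightarrow> 'a presheaf \<Rightarrow> 'a univ set" where
  "elements_arr C P = {earr (UPair c x) f (UPair d y) | c x f d y.
     UPair c x \<in> elements_obj C P \<and> UPair d y \<in> elements_obj C P \<and>
     f \<in> hom C c d \<and> pact P f y = x}"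

definition elements :: "'a ucat \<Rightarrow> 'a presheaf \<Rightarrow> 'a ucat" where
  "elements C P =
     \<lparr>Obj = elements_obj C P, Arr = elements_arr C P,
      Dom = (\<lambda>m\<in>elements_arr C P. earr_dom m),
      Cod = (\<lambda>m\<in>elements_arr C P. earr_cod m),
      Ide = (\<lambda>e\<in>elements_obj C P. earr e (Ide C (ufst e)) e),
      Comp = (\<lambda>n m. if n \<in> elements_arr C P \<and> m \<in> elements_arr C P \<and> earr_dom n = earr_cod m
        then earr (earr_dom m) (earr_base n \<cdot>\<^bsub>C\<^esub> earr_base m) (earr_cod n)
        else undefined)\<rparr>"

definition elements_proj :: "'a ucat \<Rightarrow> 'a presheaf \<Rightarrow> 'a ufun" where
  "elements_proj C P =
     \<lparr>OMap = (\<lambda>e\<in>elements_obj C P. ufst e), AMap = (\<lambda>m\<in>elements_arr C P. earr_base m)\<rparr>"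

text \<open>For \<open>F : D \<rightarrow> C\<close> and a presheaf \<open>P\<close> on \<open>C\<close>: the functor \<open>(d, x) \<mapsto> (F d, x)\<close> from the
  category of elements of \<open>P \<circ> F\<close> to that of \<open>P\<close>.\<close>

definition elements_functor :: "'a ucat \<Rightarrow> 'a presheaf \<Rightarrow> 'a ufun \<Rightarrow> 'a ufun" where
  "elements_functor D P F =
     (let Q = functor_comp (opposite D) P F; o' = (\<lambda>e. UPair (OMap F (ufst e)) (usnd e)) in
     \<lparr>OMap = (\<lambda>e\<in>elements_obj D Q. o' e),
      AMap = (\<lambda>m\<in>elements_arr D Q.
        earr (o' (earr_dom m)) (AMap F (earr_base m)) (o' (earr_cod m)))\<rparr>)"


section \<open>The category of categories with a base of computability\<close>

type_synonym 'a based_cat = "'a ucat \<times> ('a univ \<Rightarrow> 'a univ set)"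
type_synonym 'a transfer = "'a based_cat \<times> 'a based_cat \<times> 'a ufun"

definition CatBaseComp :: "('a based_cat, 'a transfer) precategory" where
  "CatBaseComp =
     (let O' = {(C, B). base_of_computability C B};
          A = {((C, B), (D, B'), F). computability_transfer C B D B' F} in
     \<lparr>Obj = O', Arr = A,
      Dom = (\<lambda>T\<in>A. fst T), Cod = (\<lambda>T\<in>A. fst (snd T)),
      Ide = (\<lambda>X\<in>O'. (X, X, functor_id (fst X))),
      Comp = (\<lambda>T' T. if T' \<in> A \<and> T \<in> A \<and> fst T' = fst (snd T)
        then (fst T, fst (snd T'), functor_comp (fst (fst T)) (snd (snd T')) (snd (snd T)))
        else undefined)\<rparr>)"

definition CBC_fHom :: "'a univ set set \<Rightarrow> 'a based_cat \<Rightarrow> 'a presheaf set" where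
  "CBC_fHom S = (\<lambda>(C, B). presheaves S C)"

definition CBC_fcomp :: "'a presheaf \<Rightarrow> 'a transfer \<Rightarrow> 'a presheaf" where
  "CBC_fcomp P = (\<lambda>((D, B), X, F). functor_comp (opposite D) P F)"

definition CBC_Sigma :: "'a based_cat \<Rightarrow> 'a presheaf \<Rightarrow> 'a based_cat" where
  "CBC_Sigma = (\<lambda>(C, B) P.
     (elements C P, preimage_base (elements C P) C (elements_proj C P) B))"

definition CBC_pr1 :: "'a based_cat \<Rightarrow> 'a presheaf \<Rightarrow> 'a transfer" where
  "CBC_pr1 = (\<lambda>(C, B) P. (CBC_Sigma (C, B) P, (C, B), elements_proj C P))"

definition CBC_Sigma_arr :: "'a presheaf \<Rightarrow> 'a transfer \<Rightarrow> 'a transfer" where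
  "CBC_Sigma_arr P = (\<lambda>((D, B), X, F).
     (CBC_Sigma (D, B) (functor_comp (opposite D) P F), CBC_Sigma X P, elements_functor D P F))"

end

theory Submission
  imports Defs
begin

text \<open>
  The laws of a type-category are laws about functors: composition of presheaves with functors is
  strictly associative and unital, and so is \<open>F \<mapsto> \<Sigma>\<^sub>P F\<close>. What has to be shown about bases is that
  all the functors in sight are computability transfers, and that the pullback property of the
  square of \<open>\<Sigma>\<^sub>P F\<close>, which holds for the underlying categories, survives the passage to transfers.

  Both follow from one property of the projection \<open>p\<close> from a category of elements: it is a
  discrete fibration, that is, every arrow into \<open>p(e)\<close> has exactly one lift with codomain \<open>e\<close>. Such
  a functor reflects monomorphisms, all arrows are cartesian for it, and it both preserves pullbacks
  and reflects them (\<open>pullback_preserve\<close>, \<open>pullback_reflect\<close>). Hence membership in the preimage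
  base only depends on the image under \<open>p\<close> (\<open>lifted_base_iff\<close>), condition \<open>Base2\<close> is obtained by
  lifting a pullback from below, and \<open>p\<close> is a transfer. Moreover a functor \<open>K\<close> into the total
  category is a transfer as soon as \<open>p \<circ> K\<close> is one (\<open>computability_transfer_into_lifted\<close>). This
  applies to \<open>\<Sigma>\<^sub>P F\<close>, since \<open>p \<circ> \<Sigma>\<^sub>P F = F \<circ> p\<close>, and to the functor \<open>K\<close> induced by a pair
  \<open>(U, V)\<close> with \<open>F \<circ> U = p \<circ> V\<close>, since \<open>p \<circ> K = U\<close>.

  A functor into the category of elements of \<open>P\<close> is the same thing as a functor \<open>U\<close> to the base
  together with a compatible choice of elements \<open>s x \<in> P(U x)\<close>; it is written
  \<open>elements_pairing X U s\<close>. As \<open>\<Sigma>\<^sub>P F\<close> changes \<open>U\<close> to \<open>F \<circ> U\<close> and keeps \<open>s\<close>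
  (\<open>elements_functor_pairing\<close>), functoriality of \<open>\<Sigma>\<^sub>P\<close> and the pullback property become identities
  between such pairs. The terminal object is the category with one arrow, with the only base that it
  admits.
\<close>

section \<open>Categories and functors\<close>

context category
begin

lemma Dom_Obj: "f \<in> Arr C \<Longrightarrow> Dom C f \<in> Obj C"
  using Dom_type by auto

lemma Cod_Obj: "f \<in> Arr C \<Longrightarrow> Cod C f \<in> Obj C"
  using Cod_type by auto

lemma hom_Obj: "f \<in> hom C a b \<Longrightarrow> a \<in> Obj C \<and> b \<in> Obj C"
  using Dom_Obj Cod_Obj by (auto simp: hom_def)

lemma Ide_Arr: "a \<in> Obj C \<Longrightarrow> Ide C a \<in> Arr C \<and> Dom C (Ide C a) = a \<and> Cod C (Ide C a) = a"
  using Ide_hom[of a] by (auto simp: hom_def)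

lemma Comp_Arr:
  assumes "f \<in> Arr C" "g \<in> Arr C" "Dom C g = Cod C f"
  shows "g \<cdot> f \<in> Arr C" "Dom C (g \<cdot> f) = Dom C f" "Cod C (g \<cdot> f) = Cod C g"
  using Comp_hom[of f "Dom C f" "Cod C f" g "Cod C g"] assms by (auto simp: hom_def)

lemma Comp_Ide:
  assumes "f \<in> Arr C"
  shows "f \<cdot> Ide C (Dom C f) = f" "Ide C (Cod C f) \<cdot> f = f"
  using assms by (auto intro: Comp_Ide_right Comp_Ide_left simp: hom_def)

lemma Comp_assoc_Arr:
  assumes "f \<in> Arr C" "g \<in> Arr C" "h \<in> Arr C" "Dom C g = Cod C f" "Dom C h = Cod C g"
  shows "(h \<cdot> g) \<cdot> f = h \<cdot> (g \<cdot> f)"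
  using assms by (intro Comp_assoc) (auto simp: hom_def)

lemma category_opposite: "category (opposite C)"
  by unfold_locales
    (use Dom_type Cod_type Ide_ext in
      \<open>auto simp: opposite_def hom_def Ide_Arr Comp_Arr Comp_Ide Comp_assoc_Arr intro: Comp_ext\<close>)

end

lemma opposite_simps [simp]:
  "Obj (opposite C) = Obj C" "Arr (opposite C) = Arr C"
  "Dom (opposite C) = Cod C" "Cod (opposite C) = Dom C" "Ide (opposite C) = Ide C"
  "g \<cdot>\<^bsub>opposite C\<^esub> f = f \<cdot>\<^bsub>C\<^esub> g" "hom (opposite C) a b = hom C b a"
  by (auto simp: opposite_def hom_def)

lemma pullback_ex1:
  assumes "pullback C f j p q" "u \<in> hom C x (Dom C f)" "v \<in> hom C x (Dom C j)"
    and "f \<cdot>\<^bsub>C\<^esub> u = j \<cdot>\<^bsub>C\<^esub> v"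
  shows "\<exists>!k. k \<in> hom C x (Dom C p) \<and> p \<cdot>\<^bsub>C\<^esub> k = u \<and> q \<cdot>\<^bsub>C\<^esub> k = v"
  using assms unfolding pullback_def by blast

context cat_functor
begin

lemma OMap_Obj: "a \<in> Obj C \<Longrightarrow> OMap F a \<in> Obj D"
  using OMap_type by auto

lemma OMap_ext: "OMap F \<in> extensional (Obj C)"
  using OMap_type by (auto simp: PiE_def)

lemma AMap_Arr:
  assumes "f \<in> Arr C"
  shows "AMap F f \<in> Arr D" "Dom D (AMap F f) = OMap F (Dom C f)"
    "Cod D (AMap F f) = OMap F (Cod C f)"
  using AMap_hom[of f "Dom C f" "Cod C f"] assms by (auto simp: hom_def)

lemma AMap_Comp_Arr:
  assumes "f \<in> Arr C" "g \<in> Arr C" "Dom C g = Cod C f"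
  shows "AMap F (g \<cdot>\<^bsub>C\<^esub> f) = AMap F g \<cdot>\<^bsub>D\<^esub> AMap F f"
  using assms by (intro AMap_Comp) (auto simp: hom_def)

end

lemma functor_map_eqI:
  fixes F G :: "('o, 'm, 'p, 'n) functor_map"
  assumes "OMap F \<in> extensional X" "OMap G \<in> extensional X"
    and "AMap F \<in> extensional Y" "AMap G \<in> extensional Y"
    and "\<And>x. x \<in> X \<Longrightarrow> OMap F x = OMap G x" "\<And>m. m \<in> Y \<Longrightarrow> AMap F m = AMap G m"
  shows "F = G"
  by (rule functor_map.equality) (auto intro: extensionalityI assms)

lemma functor_comp_simps [simp]:
  "x \<in> Obj C \<Longrightarrow> OMap (functor_comp C G F) x = OMap G (OMap F x)"
  "m \<in> Arr C \<Longrightarrow> AMap (functor_comp C G F) m = AMap G (AMap F m)"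
  "OMap (functor_comp C G F) \<in> extensional (Obj C)"
  "AMap (functor_comp C G F) \<in> extensional (Arr C)"
  by (auto simp: functor_comp_def)

lemma functor_id_simps [simp]:
  "x \<in> Obj C \<Longrightarrow> OMap (functor_id C) x = x"
  "m \<in> Arr C \<Longrightarrow> AMap (functor_id C) m = m"
  "OMap (functor_id C) \<in> extensional (Obj C)"
  "AMap (functor_id C) \<in> extensional (Arr C)"
  by (auto simp: functor_id_def)

text \<open>Composition of maps only depends on the objects and arrows of the source, so that composing a
  presheaf with \<open>F\<close> need not distinguish \<open>F\<close> from its opposite.\<close>

lemma functor_comp_opposite: "functor_comp (opposite C) G F = functor_comp C G F"
  by (simp add: functor_comp_def)

lemma cat_functor_id: "category C \<Longrightarrow> cat_functor C C (functor_id C)"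
proof -
  assume "category C"
  then interpret category C .
  show ?thesis
    by unfold_locales
      (auto simp: functor_id_def hom_def Ide_Arr Comp_Arr Dom_Obj Cod_Obj)
qed

lemma cat_functor_comp:
  assumes "cat_functor C D F" "cat_functor D E G"
  shows "cat_functor C E (functor_comp C G F)"
proof -
  interpret F: cat_functor C D F by fact
  interpret G: cat_functor D E G by fact
  show ?thesis
    by unfold_locales
      (auto simp: functor_comp_def hom_def F.AMap_Arr G.AMap_Arr F.OMap_Obj G.OMap_Obj
        F.AMap_Ide G.AMap_Ide F.AMap_Comp_Arr G.AMap_Comp_Arr F.source.Ide_Arr
        F.source.Comp_Arr F.source.Dom_Obj F.source.Cod_Obj)
qed

lemma cat_functor_opposite:
  assumes "cat_functor C D F"
  shows "cat_functor (opposite C) (opposite D) F"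
proof -
  interpret F: cat_functor C D F by fact
  interpret oC: category "opposite C" by (rule F.source.category_opposite)
  interpret oD: category "opposite D" by (rule F.target.category_opposite)
  show ?thesis
    by unfold_locales
      (use F.OMap_type F.AMap_ext in \<open>auto simp: hom_def F.AMap_Arr F.AMap_Ide F.AMap_Comp_Arr\<close>)
qed

lemma functor_comp_id_right: "cat_functor C D F \<Longrightarrow> functor_comp C F (functor_id C) = F"
  by (rule functor_map_eqI[of _ "Obj C" _ "Arr C"])
    (auto simp: cat_functor.OMap_ext cat_functor.AMap_ext)

lemma functor_comp_id_left: "cat_functor C D F \<Longrightarrow> functor_comp C (functor_id D) F = F"
  by (rule functor_map_eqI[of _ "Obj C" _ "Arr C"])
    (auto simp: cat_functor.OMap_ext cat_functor.AMap_ext cat_functor.OMap_Obj cat_functor.AMap_Arr)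

lemma functor_comp_assoc:
  assumes "cat_functor C D F"
  shows "functor_comp C (functor_comp D H G) F = functor_comp C H (functor_comp C G F)"
  by (rule functor_map_eqI[of _ "Obj C" _ "Arr C"])
    (auto simp: cat_functor.OMap_Obj[OF assms] cat_functor.AMap_Arr[OF assms])


section \<open>Discrete fibrations\<close>

locale discrete_fibration = cat_functor E C p
  for E :: "('o, 'm) precategory" and C :: "('p, 'n) precategory" and p +
  assumes unique_lift: "\<lbrakk>e \<in> Obj E; f \<in> Arr C; Cod C f = OMap p e\<rbrakk>
    \<Longrightarrow> \<exists>!m. m \<in> Arr E \<and> Cod E m = e \<and> AMap p m = f"
begin

text \<open>This is the form in which uniqueness of lifts is used: two arrows of the total category with the
  same codomain are equal, and in particular have the same domain, if their images are.\<close>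

lemma lift_unique:
  assumes "m \<in> Arr E" "m' \<in> Arr E" "Cod E m = Cod E m'" "AMap p m = AMap p m'"
  shows "m = m'"
  using unique_lift[of "Cod E m" "AMap p m"] assms
  by (metis AMap_Arr(1,3) source.Cod_Obj)

lemma obtain_lift:
  assumes "e \<in> Obj E" "f \<in> hom C x (OMap p e)"
  obtains m where "m \<in> Arr E" "Cod E m = e" "AMap p m = f" "OMap p (Dom E m) = x"
proof -
  obtain m where "m \<in> Arr E" "Cod E m = e" "AMap p m = f"
    using unique_lift[of e f] assms by (auto simp: hom_def)
  moreover from this have "OMap p (Dom E m) = x"
    using AMap_Arr(2)[of m] assms(2) by (auto simp: hom_def)
  ultimately show thesis using that by blast
qed

text \<open>The filler is the lift of \<open>h\<close> with codomain \<open>Dom E m\<close>. Its composite with \<open>m\<close> and the arrow \<open>g\<close>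
  are lifts of the same arrow with the same codomain, so they agree; only this shows that the
  lift of \<open>h\<close> starts at \<open>x\<close>.\<close>

lemma fill:
  assumes m: "m \<in> Arr E" and g: "g \<in> hom E x (Cod E m)"
    and h: "h \<in> hom C (OMap p x) (OMap p (Dom E m))"
    and eq: "AMap p m \<cdot>\<^bsub>C\<^esub> h = AMap p g"
  obtains k where "k \<in> hom E x (Dom E m)" "AMap p k = h" "m \<cdot>\<^bsub>E\<^esub> k = g"
proof -
  obtain k where k: "k \<in> Arr E" "Cod E k = Dom E m" "AMap p k = h"
    using obtain_lift[OF source.Dom_Obj[OF m] h] by blast
  have mk: "m \<cdot>\<^bsub>E\<^esub> k = g"
    using m g k eq by (intro lift_unique) (auto simp: source.Comp_Arr AMap_Comp_Arr hom_def)
  then have "Dom E k = x"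
    using m g k source.Comp_Arr(2)[of k m] by (auto simp: hom_def)
  then show thesis using that k mk by (auto simp: hom_def)
qed

lemma cartesian: "m \<in> Arr E \<Longrightarrow> cartesian E C p m"
  unfolding cartesian_def
proof (intro conjI allI ballI impI, assumption)
  fix x g h
  assume *: "m \<in> Arr E" "g \<in> hom E x (Cod E m)" "h \<in> hom C (OMap p x) (OMap p (Dom E m))"
    "AMap p m \<cdot>\<^bsub>C\<^esub> h = AMap p g"
  from fill[OF *] obtain k where "k \<in> hom E x (Dom E m)" "AMap p k = h" "m \<cdot>\<^bsub>E\<^esub> k = g" .
  then show "\<exists>!k. k \<in> hom E x (Dom E m) \<and> AMap p k = h \<and> m \<cdot>\<^bsub>E\<^esub> k = g"
    by (intro ex1I[of _ k]) (auto simp: hom_def intro: lift_unique)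
qed

lemma Mon_reflect:
  assumes m: "m \<in> Arr E" and mon: "AMap p m \<in> Mon C (OMap p (Cod E m))"
  shows "m \<in> Mon E (Cod E m)"
  unfolding Mon_def
proof (intro CollectI conjI allI ballI impI m refl)
  fix x u v
  assume uv: "u \<in> hom E x (Dom E m)" "v \<in> hom E x (Dom E m)" "m \<cdot>\<^bsub>E\<^esub> u = m \<cdot>\<^bsub>E\<^esub> v"
  then have "AMap p m \<cdot>\<^bsub>C\<^esub> AMap p u = AMap p m \<cdot>\<^bsub>C\<^esub> AMap p v"
    using m by (auto simp: hom_def simp flip: AMap_Comp_Arr)
  moreover have "AMap p u \<in> hom C (OMap p x) (Dom C (AMap p m))"
      "AMap p v \<in> hom C (OMap p x) (Dom C (AMap p m))"
    using uv m by (auto simp: hom_def AMap_Arr)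
  ultimately have "AMap p u = AMap p v"
    using mon by (auto simp: Mon_def)
  with uv show "u = v"
    by (intro lift_unique) (auto simp: hom_def)
qed

text \<open>A cone over the image of the square lifts to a cone over the square: the lifts of its two legs
  have the same domain because, followed by \<open>f\<close> and \<open>j\<close>, they are lifts of one and the same arrow.\<close>

lemma pullback_preserve:
  assumes pb: "pullback E f j r q"
  shows "pullback C (AMap p f) (AMap p j) (AMap p r) (AMap p q)"
proof -
  have arr: "f \<in> Arr E" "j \<in> Arr E" "r \<in> Arr E" "q \<in> Arr E" "Cod E f = Cod E j"
    "Cod E r = Dom E f" "Cod E q = Dom E j" "Dom E q = Dom E r" "f \<cdot>\<^bsub>E\<^esub> r = j \<cdot>\<^bsub>E\<^esub> q"
    using pb by (auto simp: pullback_def hom_def)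
  have comm: "AMap p f \<cdot>\<^bsub>C\<^esub> AMap p r = AMap p j \<cdot>\<^bsub>C\<^esub> AMap p q"
    using arr by (metis AMap_Comp_Arr)
  show ?thesis
    unfolding pullback_def
  proof (intro conjI allI ballI impI)
    fix x u v
    assume u: "u \<in> hom C x (Dom C (AMap p f))" and v: "v \<in> hom C x (Dom C (AMap p j))"
      and uv: "AMap p f \<cdot>\<^bsub>C\<^esub> u = AMap p j \<cdot>\<^bsub>C\<^esub> v"
    obtain u' where u': "u' \<in> Arr E" "Cod E u' = Dom E f" "AMap p u' = u" "OMap p (Dom E u') = x"
      using obtain_lift[of "Dom E f" u x] u arr by (auto simp: source.Dom_Obj AMap_Arr)
    obtain v' where v': "v' \<in> Arr E" "Cod E v' = Dom E j" "AMap p v' = v"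
      using obtain_lift[of "Dom E j" v x] v arr by (auto simp: source.Dom_Obj AMap_Arr)
    \<comment> \<open>The domains of \<open>u'\<close> and \<open>v'\<close> are read off from this equation.\<close>
    have "f \<cdot>\<^bsub>E\<^esub> u' = j \<cdot>\<^bsub>E\<^esub> v'"
      using arr u' v' uv by (intro lift_unique) (auto simp: source.Comp_Arr AMap_Comp_Arr)
    moreover from this have dom: "Dom E u' = Dom E v'"
      using arr u' v' by (metis source.Comp_Arr(2))
    ultimately have ex: "\<exists>!k. k \<in> hom E (Dom E u') (Dom E r) \<and> r \<cdot>\<^bsub>E\<^esub> k = u' \<and> q \<cdot>\<^bsub>E\<^esub> k = v'"
      using u' v' by (intro pullback_ex1[OF pb]) (auto simp: hom_def)
    then obtain k where k: "k \<in> Arr E" "Dom E k = Dom E u'" "Cod E k = Dom E r"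
      "r \<cdot>\<^bsub>E\<^esub> k = u'" "q \<cdot>\<^bsub>E\<^esub> k = v'"
      by (auto simp: hom_def)
    show "\<exists>!k. k \<in> hom C x (Dom C (AMap p r)) \<and> AMap p r \<cdot>\<^bsub>C\<^esub> k = u \<and> AMap p q \<cdot>\<^bsub>C\<^esub> k = v"
    proof (rule ex1I[of _ "AMap p k"])
      show "AMap p k \<in> hom C x (Dom C (AMap p r)) \<and> AMap p r \<cdot>\<^bsub>C\<^esub> AMap p k = u
          \<and> AMap p q \<cdot>\<^bsub>C\<^esub> AMap p k = v"
        using k arr u' v' by (auto simp: hom_def AMap_Arr simp flip: AMap_Comp_Arr)
    next
      fix l
      assume l: "l \<in> hom C x (Dom C (AMap p r)) \<and> AMap p r \<cdot>\<^bsub>C\<^esub> l = u \<and> AMap p q \<cdot>\<^bsub>C\<^esub> l = v"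
      then obtain l' where l': "l' \<in> Arr E" "Cod E l' = Dom E r" "AMap p l' = l"
        using obtain_lift[of "Dom E r" l x] arr by (auto simp: source.Dom_Obj AMap_Arr)
      have "r \<cdot>\<^bsub>E\<^esub> l' = u'" "q \<cdot>\<^bsub>E\<^esub> l' = v'"
        using arr u' v' l' l
        by (auto intro!: lift_unique simp: source.Comp_Arr AMap_Comp_Arr)
      moreover from this have "Dom E l' = Dom E u'"
        using arr l' by (metis source.Comp_Arr(2))
      ultimately have "l' = k"
        using ex l' k by (auto simp: hom_def)
      then show "l = AMap p k" using l' by simp
    qed
  qed (use arr comm in \<open>auto simp: AMap_Arr hom_def\<close>)
qed

text \<open>Commutativity of the square, and with it the equality of the domains of \<open>r\<close> and \<open>q\<close>, follow
  from uniqueness of lifts. This makes the lemma applicable to two arrows that were lifted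
  separately, as in the proof of \<open>Base2\<close> below.\<close>

lemma pullback_reflect:
  assumes arr: "f \<in> Arr E" "j \<in> Arr E" "r \<in> Arr E" "q \<in> Arr E" "Cod E f = Cod E j"
    "Cod E r = Dom E f" "Cod E q = Dom E j"
    and pb: "pullback C (AMap p f) (AMap p j) (AMap p r) (AMap p q)"
  shows "pullback E f j r q"
proof -
  have comm: "f \<cdot>\<^bsub>E\<^esub> r = j \<cdot>\<^bsub>E\<^esub> q"
    using arr pb
    by (intro lift_unique) (auto simp: source.Comp_Arr AMap_Comp_Arr pullback_def)
  then have dom: "Dom E q = Dom E r"
    using arr by (metis source.Comp_Arr(2))
  show ?thesis
    unfolding pullback_def
  proof (intro conjI allI ballI impI)
    fix x u v
    assume u: "u \<in> hom E x (Dom E f)" and v: "v \<in> hom E x (Dom E j)" and uv: "f \<cdot>\<^bsub>E\<^esub> u = j \<cdot>\<^bsub>E\<^esub> v"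
    have "AMap p u \<in> hom C (OMap p x) (Dom C (AMap p f))"
        "AMap p v \<in> hom C (OMap p x) (Dom C (AMap p j))"
      using u v arr by (auto simp: hom_def AMap_Arr)
    moreover have "AMap p f \<cdot>\<^bsub>C\<^esub> AMap p u = AMap p j \<cdot>\<^bsub>C\<^esub> AMap p v"
      using u v uv arr by (auto simp: hom_def simp flip: AMap_Comp_Arr)
    ultimately have ex: "\<exists>!k. k \<in> hom C (OMap p x) (Dom C (AMap p r))
        \<and> AMap p r \<cdot>\<^bsub>C\<^esub> k = AMap p u \<and> AMap p q \<cdot>\<^bsub>C\<^esub> k = AMap p v"
      by (rule pullback_ex1[OF pb])
    then obtain k where k: "k \<in> hom C (OMap p x) (OMap p (Dom E r))"
      "AMap p r \<cdot>\<^bsub>C\<^esub> k = AMap p u" "AMap p q \<cdot>\<^bsub>C\<^esub> k = AMap p v"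
      using arr by (auto simp: AMap_Arr)
    obtain k' where k': "k' \<in> hom E x (Dom E r)" "AMap p k' = k" "r \<cdot>\<^bsub>E\<^esub> k' = u"
      using fill[OF arr(3) _ k(1,2)] u arr by auto
    have "q \<cdot>\<^bsub>E\<^esub> k' = v"
      using k k' v arr dom
      by (intro lift_unique) (auto simp: source.Comp_Arr AMap_Comp_Arr hom_def)
    show "\<exists>!k. k \<in> hom E x (Dom E r) \<and> r \<cdot>\<^bsub>E\<^esub> k = u \<and> q \<cdot>\<^bsub>E\<^esub> k = v"
    proof (rule ex1I[of _ k'])
      fix l
      assume l: "l \<in> hom E x (Dom E r) \<and> r \<cdot>\<^bsub>E\<^esub> l = u \<and> q \<cdot>\<^bsub>E\<^esub> l = v"
      then have "AMap p r \<cdot>\<^bsub>C\<^esub> AMap p l = AMap p u" "AMap p q \<cdot>\<^bsub>C\<^esub> AMap p l = AMap p v"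
        using arr dom by (auto simp: hom_def simp flip: AMap_Comp_Arr)
      moreover have "AMap p l \<in> hom C (OMap p x) (Dom C (AMap p r))"
        using l arr by (auto simp: hom_def AMap_Arr)
      ultimately have "AMap p l = AMap p k'"
        using ex k k'(2) arr by (auto simp: AMap_Arr)
      then show "l = k'"
        using l k' by (intro lift_unique) (auto simp: hom_def)
    qed (use k' \<open>q \<cdot>\<^bsub>E\<^esub> k' = v\<close> in simp)
  qed (use arr comm dom in \<open>auto simp: hom_def\<close>)
qed

end


section \<open>The base of computability on a discrete fibration\<close>

locale based_discrete_fibration = discrete_fibration E C p + base: base_of_computability C B
  for E :: "('o, 'm) precategory" and C :: "('p, 'n) precategory" and p and B
begin

abbreviation lifted_base :: "'o \<Rightarrow> 'm set" where
  "lifted_base \<equiv> preimage_base E C p B"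

text \<open>Monomorphisms are reflected and all arrows are cartesian, which leaves the condition on the
  image.\<close>

lemma lifted_base_iff:
  assumes "e \<in> Obj E"
  shows "m \<in> lifted_base e \<longleftrightarrow> m \<in> Arr E \<and> Cod E m = e \<and> AMap p m \<in> B (OMap p e)"
  using assms Mon_reflect[of m] cartesian[of m] base.Base_Mon[OF OMap_Obj[OF assms]]
  by (auto simp: preimage_base_def Mon_def[of E])

text \<open>For \<open>Base2\<close>, the two projections of a pullback in \<open>C\<close> are lifted and the resulting square is a
  pullback by reflection.\<close>

lemma base_of_computability_lifted: "base_of_computability E lifted_base"
proof unfold_locales
  show "lifted_base \<in> extensional (Obj E)" by (simp add: preimage_base_def)
  show "lifted_base a \<subseteq> Mon E a" if "a \<in> Obj E" for a
    using that by (auto simp: preimage_base_def)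
  show "Ide E a \<in> lifted_base a" if "a \<in> Obj E" for a
    using that by (simp add: lifted_base_iff source.Ide_Arr AMap_Ide OMap_Obj base.Base1)
next
  fix a b i j f
  assume ab: "a \<in> Obj E" "b \<in> Obj E" and "i \<in> lifted_base a" "j \<in> lifted_base b"
    and "f \<in> hom E (Dom E i) b"
  then have i: "i \<in> Arr E" "Cod E i = a" "AMap p i \<in> B (OMap p a)"
    and j: "j \<in> Arr E" "Cod E j = b" "AMap p j \<in> B (OMap p b)"
    and f: "f \<in> Arr E" "Dom E f = Dom E i" "Cod E f = b"
    by (auto simp: lifted_base_iff hom_def)
  obtain r q where pb: "pullback C (AMap p f) (AMap p j) r q" and ir: "AMap p i \<cdot>\<^bsub>C\<^esub> r \<in> B (OMap p a)"
    using base.Base2[of "OMap p a" "OMap p b" "AMap p i" "AMap p j" "AMap p f"] ab i j f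
    by (auto simp: OMap_Obj AMap_Arr hom_def)
  have rq: "r \<in> hom C (Dom C r) (OMap p (Dom E f))" "q \<in> hom C (Dom C r) (OMap p (Dom E j))"
    using pb f(1) j(1) by (auto simp: pullback_def AMap_Arr)
  obtain r' where r': "r' \<in> Arr E" "Cod E r' = Dom E f" "AMap p r' = r"
    using obtain_lift[OF source.Dom_Obj[OF f(1)] rq(1)] by metis
  obtain q' where q': "q' \<in> Arr E" "Cod E q' = Dom E j" "AMap p q' = q"
    using obtain_lift[OF source.Dom_Obj[OF j(1)] rq(2)] by metis
  have "pullback E f j r' q'"
    using pb f j r' q' by (intro pullback_reflect) auto
  moreover have "i \<cdot>\<^bsub>E\<^esub> r' \<in> lifted_base a"
    using ab i f r' ir by (simp add: lifted_base_iff source.Comp_Arr AMap_Comp_Arr)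
  ultimately show "\<exists>r q. pullback E f j r q \<and> i \<cdot>\<^bsub>E\<^esub> r \<in> lifted_base a" by blast
qed

lemma computability_transfer_proj: "computability_transfer E lifted_base C B p"
proof -
  interpret lifted: base_of_computability E lifted_base by (rule base_of_computability_lifted)
  show ?thesis
    by unfold_locales (auto simp: lifted_base_iff intro: pullback_preserve)
qed

text \<open>Membership in the lifted base and being a pullback can both be tested after applying \<open>p\<close>.\<close>

lemma computability_transfer_into_lifted:
  assumes K: "cat_functor X E K" and pK: "computability_transfer X B' C B (functor_comp X p K)"
  shows "computability_transfer X B' E lifted_base K"
proof -
  interpret K: cat_functor X E K by fact
  interpret pK: computability_transfer X B' C B "functor_comp X p K" by fact
  interpret lifted: base_of_computability E lifted_base by (rule base_of_computability_lifted)
  show ?thesis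
  proof unfold_locales
    fix a i
    assume a: "a \<in> Obj X" and i: "i \<in> B' a"
    then have "i \<in> Arr X" "Cod X i = a"
      using pK.source.Base_Mon[OF a] by (auto simp: Mon_def)
    then show "AMap K i \<in> lifted_base (OMap K a)"
      using a i pK.transfer_base[OF a i] by (simp add: lifted_base_iff K.OMap_Obj K.AMap_Arr)
  next
    fix b j f s r q
    assume *: "b \<in> Obj X" "j \<in> B' b" "f \<in> hom X s b" "pullback X f j r q"
    then show "pullback E (AMap K f) (AMap K j) (AMap K r) (AMap K q)"
      using pK.transfer_pullback[OF *]
      by (intro pullback_reflect) (auto simp: pullback_def hom_def K.AMap_Arr)
  qed
qed

end


section \<open>Presheaves and categories of elements\<close>

lemma Sets_simps:
  "Obj (Sets S) = S"
  "(X, Y, h) \<in> Arr (Sets S) \<longleftrightarrow> X \<in> S \<and> Y \<in> S \<and> h \<in> X \<rightarrow>\<^sub>E Y"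
  "m \<in> hom (Sets S) X Y \<longleftrightarrow> (\<exists>h. m = (X, Y, h) \<and> X \<in> S \<and> Y \<in> S \<and> h \<in> X \<rightarrow>\<^sub>E Y)"
  "X \<in> S \<Longrightarrow> Ide (Sets S) X = (X, X, \<lambda>x\<in>X. x)"
  "\<lbrakk>X \<in> S; Y \<in> S; Z \<in> S; h \<in> X \<rightarrow>\<^sub>E Y; k \<in> Y \<rightarrow>\<^sub>E Z\<rbrakk>
    \<Longrightarrow> (Y, Z, k) \<cdot>\<^bsub>Sets S\<^esub> (X, Y, h) = (X, Z, compose X k h)"
  by (auto simp: Sets_def Let_def hom_def)

locale presheaf = category C + psh: cat_functor "opposite C" "Sets S" P
  for S :: "'a univ set set" and C :: "'a ucat" and P :: "'a presheaf"

lemma presheaves_iff: "category C \<Longrightarrow> P \<in> presheaves S C \<longleftrightarrow> presheaf S C P"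
  by (auto simp: presheaves_def presheaf_def)

lemma presheaf_comp:
  assumes "cat_functor D C F" "presheaf S C P"
  shows "presheaf S D (functor_comp D P F)"
proof -
  interpret presheaf S C P by fact
  interpret F: cat_functor D C F by fact
  have "cat_functor (opposite D) (Sets S) (functor_comp (opposite D) P F)"
    using cat_functor_opposite[OF assms(1)] psh.cat_functor_axioms by (rule cat_functor_comp)
  then show ?thesis
    by (simp add: presheaf_def functor_comp_opposite F.source.category_axioms)
qed

lemma functor_comp_presheaf_id:
  assumes "presheaf S C P"
  shows "functor_comp C P (functor_id C) = P"
proof -
  interpret presheaf S C P by fact
  show ?thesis
    using functor_comp_id_right[OF psh.cat_functor_axioms]
    by (simp add: functor_comp_opposite functor_id_def)
qed

lemma pact_functor_comp: "f \<in> Arr D \<Longrightarrow> pact (functor_comp D P F) f = pact P (AMap F f)"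
  by (simp add: pact_def)

lemma earr_simps [simp]:
  "earr_dom (earr e f e') = e" "earr_base (earr e f e') = f" "earr_cod (earr e f e') = e'"
  "earr e f e' = earr d g d' \<longleftrightarrow> e = d \<and> f = g \<and> e' = d'"
  by (auto simp: earr_def earr_dom_def earr_base_def earr_cod_def)

lemma elements_obj_iff: "e \<in> elements_obj C P \<longleftrightarrow>
    e = UPair (ufst e) (usnd e) \<and> ufst e \<in> Obj C \<and> usnd e \<in> OMap P (ufst e)"
  by (cases e) (auto simp: elements_obj_def)

lemma earr_in_elements_arr: "earr e f e' \<in> elements_arr C P \<longleftrightarrow>
    e \<in> elements_obj C P \<and> e' \<in> elements_obj C P \<and> f \<in> hom C (ufst e) (ufst e')
    \<and> pact P f (usnd e') = usnd e"
  by (fastforce simp: elements_arr_def elements_obj_def)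

lemma elements_arrE:
  assumes "m \<in> elements_arr C P"
  obtains e f e' where "m = earr e f e'" "earr e f e' \<in> elements_arr C P"
  using assms by (auto simp: elements_arr_def)

lemma elements_simps [simp]:
  "Obj (elements C P) = elements_obj C P" "Arr (elements C P) = elements_arr C P"
  "earr e f e' \<in> elements_arr C P \<Longrightarrow> Dom (elements C P) (earr e f e') = e"
  "earr e f e' \<in> elements_arr C P \<Longrightarrow> Cod (elements C P) (earr e f e') = e'"
  "e \<in> elements_obj C P \<Longrightarrow> Ide (elements C P) e = earr e (Ide C (ufst e)) e"
  "\<lbrakk>earr e f e' \<in> elements_arr C P; earr e' g e'' \<in> elements_arr C P\<rbrakk>
    \<Longrightarrow> earr e' g e'' \<cdot>\<^bsub>elements C P\<^esub> earr e f e' = earr e (g \<cdot>\<^bsub>C\<^esub> f) e''"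
  by (auto simp: elements_def)

lemma elements_hom_iff:
  "m \<in> hom (elements C P) e e' \<longleftrightarrow> (\<exists>f. m = earr e f e' \<and> earr e f e' \<in> elements_arr C P)"
proof
  assume m: "m \<in> hom (elements C P) e e'"
  then have "m \<in> elements_arr C P" by (simp add: hom_def)
  then show "\<exists>f. m = earr e f e' \<and> earr e f e' \<in> elements_arr C P"
    by (rule elements_arrE) (use m in \<open>auto simp: hom_def\<close>)
qed (auto simp: hom_def)

lemma elements_proj_simps [simp]:
  "e \<in> elements_obj C P \<Longrightarrow> OMap (elements_proj C P) e = ufst e"
  "earr e f e' \<in> elements_arr C P \<Longrightarrow> AMap (elements_proj C P) (earr e f e') = f"
  by (auto simp: elements_proj_def)

text \<open>The functor \<open>x \<mapsto> (U x, s x)\<close>. It is given by its formula for any \<open>s\<close>; it is a functor into the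
  category of elements when \<open>s\<close> is a section of \<open>P \<circ> U\<close>, see \<open>cat_functor_pairing\<close> below.\<close>

definition elements_pairing ::
    "'a ucat \<Rightarrow> 'a ufun \<Rightarrow> ('a univ \<Rightarrow> 'a univ) \<Rightarrow> 'a ufun" where
  "elements_pairing X U s =
     \<lparr>OMap = (\<lambda>x\<in>Obj X. UPair (OMap U x) (s x)),
      AMap = (\<lambda>m\<in>Arr X. earr (UPair (OMap U (Dom X m)) (s (Dom X m))) (AMap U m)
        (UPair (OMap U (Cod X m)) (s (Cod X m))))\<rparr>"

lemma elements_pairing_simps [simp]:
  "x \<in> Obj X \<Longrightarrow> OMap (elements_pairing X U s) x = UPair (OMap U x) (s x)"
  "m \<in> Arr X \<Longrightarrow> AMap (elements_pairing X U s) m =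
    earr (UPair (OMap U (Dom X m)) (s (Dom X m))) (AMap U m)
      (UPair (OMap U (Cod X m)) (s (Cod X m)))"
  "OMap (elements_pairing X U s) \<in> extensional (Obj X)"
  "AMap (elements_pairing X U s) \<in> extensional (Arr X)"
  by (auto simp: elements_pairing_def)

context presheaf
begin

abbreviation (input) "E \<equiv> elements C P"
abbreviation (input) "pr \<equiv> elements_proj C P"

lemma pact_Arr:
  assumes "f \<in> hom C c d"
  shows "pact P f \<in> OMap P d \<rightarrow> OMap P c"
  using psh.AMap_hom[of f d c] assms by (auto simp: Sets_simps pact_def)

lemma pact_Ide: "c \<in> Obj C \<Longrightarrow> x \<in> OMap P c \<Longrightarrow> pact P (Ide C c) x = x"
  using psh.AMap_Ide[of c] psh.OMap_Obj[of c] by (simp add: pact_def Sets_simps)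

lemma pact_Comp:
  assumes f: "f \<in> hom C c d" and g: "g \<in> hom C d e" and z: "z \<in> OMap P e"
  shows "pact P (g \<cdot>\<^bsub>C\<^esub> f) z = pact P f (pact P g z)"
proof -
  obtain h k where "AMap P f = (OMap P d, OMap P c, h)" "h \<in> OMap P d \<rightarrow>\<^sub>E OMap P c"
    "AMap P g = (OMap P e, OMap P d, k)" "k \<in> OMap P e \<rightarrow>\<^sub>E OMap P d"
    and "OMap P c \<in> S" "OMap P d \<in> S" "OMap P e \<in> S"
    using psh.AMap_hom[of f d c] psh.AMap_hom[of g e d] f g by (auto simp: Sets_simps)
  then show ?thesis
    using psh.AMap_Comp[of g e d f c] f g z by (simp add: pact_def Sets_simps compose_def)
qed

lemma pact_Comp_elements:
  assumes "earr e f e' \<in> elements_arr C P" "earr e' g e'' \<in> elements_arr C P"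
  shows "earr e (g \<cdot>\<^bsub>C\<^esub> f) e'' \<in> elements_arr C P"
  using assms pact_Comp[of f "ufst e" "ufst e'" g "ufst e''" "usnd e''"]
  by (auto simp: earr_in_elements_arr elements_obj_iff[of e''] Comp_hom)

lemma Ide_elements: "e \<in> elements_obj C P \<Longrightarrow> earr e (Ide C (ufst e)) e \<in> elements_arr C P"
  by (auto simp: earr_in_elements_arr elements_obj_iff Ide_hom pact_Ide)

lemma category_elements: "category (elements C P)"
proof unfold_locales
  show "Dom E \<in> Arr E \<rightarrow>\<^sub>E Obj E" "Cod E \<in> Arr E \<rightarrow>\<^sub>E Obj E" "Ide E \<in> extensional (Obj E)"
    by (auto simp: elements_def elements_arr_def)
  show "g \<cdot>\<^bsub>E\<^esub> f = undefined" if "\<not> (g \<in> Arr E \<and> f \<in> Arr E \<and> Dom E g = Cod E f)" for g f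
    using that by (auto simp: elements_def)
next
  fix f a b
  assume "f \<in> hom E a b"
  then obtain h where h: "f = earr a h b" "earr a h b \<in> elements_arr C P"
    by (auto simp: elements_hom_iff)
  moreover from h(2) have "a \<in> elements_obj C P" "b \<in> elements_obj C P" "h \<in> hom C (ufst a) (ufst b)"
    by (simp_all add: earr_in_elements_arr)
  ultimately show "f \<cdot>\<^bsub>E\<^esub> Ide E a = f" "Ide E b \<cdot>\<^bsub>E\<^esub> f = f"
    by (simp_all add: Ide_elements Comp_Ide_left Comp_Ide_right)
next
  fix f g h a b c d
  assume "f \<in> hom E a b" "g \<in> hom E b c" "h \<in> hom E c d"
  then obtain f' g' h' where *: "f = earr a f' b" "g = earr b g' c" "h = earr c h' d"
    "earr a f' b \<in> elements_arr C P" "earr b g' c \<in> elements_arr C P" "earr c h' d \<in> elements_arr C P"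
    by (auto simp: elements_hom_iff)
  moreover from *(4-6) have "f' \<in> hom C (ufst a) (ufst b)" "g' \<in> hom C (ufst b) (ufst c)"
    "h' \<in> hom C (ufst c) (ufst d)"
    by (simp_all add: earr_in_elements_arr)
  ultimately show "(h \<cdot>\<^bsub>E\<^esub> g) \<cdot>\<^bsub>E\<^esub> f = h \<cdot>\<^bsub>E\<^esub> (g \<cdot>\<^bsub>E\<^esub> f)"
    by (simp add: pact_Comp_elements Comp_assoc)
qed (auto simp: elements_hom_iff pact_Comp_elements Ide_elements)

text \<open>The lift of \<open>f : c \<rightarrow> d\<close> with codomain \<open>(d, y)\<close> has to start at \<open>(c, P(f)(y))\<close>.\<close>

lemma discrete_fibration_proj: "discrete_fibration (elements C P) C (elements_proj C P)"
proof -
  interpret E: category E by (rule category_elements)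
  show ?thesis
  proof unfold_locales
    show "OMap pr \<in> Obj E \<rightarrow>\<^sub>E Obj C" "AMap pr \<in> extensional (Arr E)"
      by (auto simp: elements_proj_def elements_obj_iff)
  next
    fix e f
    assume "e \<in> Obj E" "f \<in> Arr C" "Cod C f = OMap pr e"
    then have *: "e \<in> elements_obj C P" "f \<in> hom C (Dom C f) (ufst e)"
      by (auto simp: hom_def)
    define d where "d = UPair (Dom C f) (pact P f (usnd e))"
    have d: "earr d f e \<in> elements_arr C P"
      using * pact_Arr[OF *(2)] hom_Obj[OF *(2)]
      by (auto simp: d_def earr_in_elements_arr elements_obj_iff[of "UPair _ _"]
          elements_obj_iff[of e])
    show "\<exists>!m. m \<in> Arr E \<and> Cod E m = e \<and> AMap pr m = f"
    proof (rule ex1I[of _ "earr d f e"])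
      fix m
      assume m: "m \<in> Arr E \<and> Cod E m = e \<and> AMap pr m = f"
      then obtain d' where m': "m = earr d' f e" "earr d' f e \<in> elements_arr C P"
        by (metis elements_arrE elements_proj_simps(2) elements_simps(2,4))
      then have "d' = d"
        by (auto simp: d_def earr_in_elements_arr elements_obj_iff[of d'] hom_def)
      with m' show "m = earr d f e" by simp
    qed (use d in auto)
  next
    show "AMap pr f \<in> hom C (OMap pr a) (OMap pr b)" if "f \<in> hom E a b" for f a b
      using that by (auto simp: elements_hom_iff) (auto simp: earr_in_elements_arr)
  qed (auto simp: elements_hom_iff Ide_elements pact_Comp_elements)
qed

lemma cat_functor_proj: "cat_functor (elements C P) C (elements_proj C P)"
  using discrete_fibration_proj by (rule discrete_fibration.axioms)

lemma cat_functor_pairing: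
  assumes U: "cat_functor X C U"
    and s: "\<And>x. x \<in> Obj X \<Longrightarrow> s x \<in> OMap P (OMap U x)"
    and nat: "\<And>m. m \<in> Arr X \<Longrightarrow> pact P (AMap U m) (s (Cod X m)) = s (Dom X m)"
  shows "cat_functor X (elements C P) (elements_pairing X U s)"
proof -
  interpret U: cat_functor X C U by fact
  interpret E: category E by (rule category_elements)
  have obj: "UPair (OMap U x) (s x) \<in> elements_obj C P" if "x \<in> Obj X" for x
    using that s by (simp add: elements_obj_iff U.OMap_Obj)
  have arr: "earr (UPair (OMap U x) (s x)) (AMap U m) (UPair (OMap U y) (s y)) \<in> elements_arr C P"
    if "m \<in> hom X x y" for m x y
    using that nat obj U.source.hom_Obj[OF that] U.AMap_hom[OF that]
    by (auto simp: earr_in_elements_arr hom_def)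
  show ?thesis
  proof unfold_locales
    fix f g a b c
    assume f: "f \<in> hom X a b" and g: "g \<in> hom X b c"
    then show "AMap (elements_pairing X U s) (g \<cdot>\<^bsub>X\<^esub> f) =
        AMap (elements_pairing X U s) g \<cdot>\<^bsub>E\<^esub> AMap (elements_pairing X U s) f"
      using arr[OF f] arr[OF g]
      by (auto simp: hom_def U.source.Comp_Arr U.AMap_Comp_Arr)
  next
    fix f a b
    assume f: "f \<in> hom X a b"
    then show "AMap (elements_pairing X U s) f \<in>
        hom E (OMap (elements_pairing X U s) a) (OMap (elements_pairing X U s) b)"
      using arr[OF f] U.source.hom_Obj[OF f] by (auto simp: hom_def)
  qed (auto simp: obj elements_pairing_def U.source.Ide_Arr U.AMap_Ide)
qed

text \<open>The second components of a functor into the category of elements satisfy the hypotheses of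
  \<open>cat_functor_pairing\<close>; thus \<open>pairing_eq\<close> and \<open>proj_pairing\<close> below say that functors into the
  category of elements correspond to pairs of a functor \<open>U\<close> and a section of \<open>P \<circ> U\<close>.\<close>

lemma cat_functor_elementsD:
  assumes "cat_functor X (elements C P) K"
  shows "x \<in> Obj X \<Longrightarrow> usnd (OMap K x) \<in> OMap P (ufst (OMap K x))"
    and "m \<in> Arr X \<Longrightarrow>
      pact P (earr_base (AMap K m)) (usnd (OMap K (Cod X m))) = usnd (OMap K (Dom X m))"
proof -
  interpret K: cat_functor X E K by fact
  show "x \<in> Obj X \<Longrightarrow> usnd (OMap K x) \<in> OMap P (ufst (OMap K x))"
    using K.OMap_Obj[of x] by (simp add: elements_obj_iff)
  assume "m \<in> Arr X"
  then have "AMap K m \<in> hom E (OMap K (Dom X m)) (OMap K (Cod X m))"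
    by (intro K.AMap_hom) (simp add: hom_def)
  then show "pact P (earr_base (AMap K m)) (usnd (OMap K (Cod X m))) = usnd (OMap K (Dom X m))"
    by (auto simp: elements_hom_iff earr_in_elements_arr)
qed

lemma pairing_eq:
  assumes "cat_functor X (elements C P) K"
  shows "K = elements_pairing X (functor_comp X (elements_proj C P) K) (\<lambda>x. usnd (OMap K x))"
proof -
  interpret K: cat_functor X E K by fact
  have obj: "UPair (ufst (OMap K x)) (usnd (OMap K x)) = OMap K x" if "x \<in> Obj X" for x
    using K.OMap_Obj[OF that] by (simp add: elements_obj_iff)
  show ?thesis
  proof (rule functor_map_eqI[of _ "Obj X" _ "Arr X"])
    fix m
    assume m: "m \<in> Arr X"
    then have "AMap K m \<in> hom E (OMap K (Dom X m)) (OMap K (Cod X m))"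
      by (intro K.AMap_hom) (simp add: hom_def)
    then obtain f where "AMap K m = earr (OMap K (Dom X m)) f (OMap K (Cod X m))"
      "earr (OMap K (Dom X m)) f (OMap K (Cod X m)) \<in> elements_arr C P"
      by (auto simp: elements_hom_iff)
    then show "AMap K m = AMap (elements_pairing X (functor_comp X pr K) (\<lambda>x. usnd (OMap K x))) m"
      using m obj K.OMap_Obj by (simp add: K.source.Dom_Obj K.source.Cod_Obj)
  qed (use obj K.OMap_Obj in \<open>auto simp: K.OMap_ext K.AMap_ext\<close>)
qed

lemma proj_pairing:
  assumes U: "cat_functor X C U" and K: "cat_functor X (elements C P) (elements_pairing X U s)"
  shows "functor_comp X (elements_proj C P) (elements_pairing X U s) = U"
proof -
  interpret U: cat_functor X C U by fact
  interpret K: cat_functor X E "elements_pairing X U s" by fact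
  show ?thesis
    by (rule functor_map_eqI[of _ "Obj X" _ "Arr X"])
      (use K.OMap_Obj K.AMap_Arr(1) in \<open>auto simp: U.OMap_ext U.AMap_ext\<close>)
qed

end

text \<open>In terms of pairs, \<open>\<Sigma>\<^sub>P F\<close> has first component \<open>F \<circ> p\<close> and the tautological section \<open>(d, x) \<mapsto> x\<close>.
  Its properties are instances of those of pairs.\<close>

lemma elements_functor_eq_pairing:
  assumes "cat_functor D C F" "presheaf S C P"
  shows "elements_functor D P F = elements_pairing (elements D (functor_comp D P F))
    (functor_comp (elements D (functor_comp D P F)) F (elements_proj D (functor_comp D P F))) usnd"
    (is "_ = elements_pairing (elements D ?Q) _ _")
proof (rule functor_map_eqI[of _ "elements_obj D ?Q" _ "elements_arr D ?Q"])
  interpret Q: presheaf S D ?Q using assms by (rule presheaf_comp)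
  fix m
  assume "m \<in> elements_arr D ?Q"
  then obtain d g d' where m: "m = earr d g d'" "earr d g d' \<in> elements_arr D ?Q"
    by (rule elements_arrE)
  moreover from m(2) have "d \<in> elements_obj D ?Q" "d' \<in> elements_obj D ?Q"
    by (auto simp: earr_in_elements_arr)
  ultimately show "AMap (elements_functor D P F) m = AMap (elements_pairing (elements D ?Q)
      (functor_comp (elements D ?Q) F (elements_proj D ?Q)) usnd) m"
    by (simp add: elements_functor_def Let_def functor_comp_opposite)
next
  show "OMap (elements_pairing (elements D ?Q) (functor_comp (elements D ?Q) F
      (elements_proj D ?Q)) usnd) \<in> extensional (elements_obj D ?Q)"
    "AMap (elements_pairing (elements D ?Q) (functor_comp (elements D ?Q) F
      (elements_proj D ?Q)) usnd) \<in> extensional (elements_arr D ?Q)"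
    using elements_pairing_simps(3,4)[of "elements D ?Q"] by simp_all
qed (auto simp: elements_functor_def Let_def functor_comp_opposite)

lemma cat_functor_elements_functor:
  assumes F: "cat_functor D C F" and P: "presheaf S C P"
  shows "cat_functor (elements D (functor_comp D P F)) (elements C P) (elements_functor D P F)"
proof -
  let ?Q = "functor_comp D P F"
  interpret F: cat_functor D C F by fact
  interpret P: presheaf S C P by fact
  interpret Q: presheaf S D ?Q using assms by (rule presheaf_comp)
  have "cat_functor (elements D ?Q) C (functor_comp (elements D ?Q) F (elements_proj D ?Q))"
    using Q.cat_functor_proj F by (rule cat_functor_comp)
  then show ?thesis
    unfolding elements_functor_eq_pairing[OF assms]
  proof (rule P.cat_functor_pairing)
    show "usnd x \<in> OMap P (OMap (functor_comp (elements D ?Q) F (elements_proj D ?Q)) x)"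
      if "x \<in> Obj (elements D ?Q)" for x
      using that by (auto simp: elements_obj_iff)
  next
    fix m
    assume "m \<in> Arr (elements D ?Q)"
    then have "m \<in> elements_arr D ?Q" by simp
    then obtain d g d' where m: "m = earr d g d'" "earr d g d' \<in> elements_arr D ?Q"
      by (rule elements_arrE)
    moreover from m(2) have "g \<in> Arr D" "pact ?Q g (usnd d') = usnd d"
      by (auto simp: earr_in_elements_arr hom_def)
    ultimately show "pact P (AMap (functor_comp (elements D ?Q) F (elements_proj D ?Q)) m)
        (usnd (Cod (elements D ?Q) m)) = usnd (Dom (elements D ?Q) m)"
      by (simp add: pact_functor_comp)
  qed
qed

lemma proj_elements_functor:
  assumes F: "cat_functor D C F" and P: "presheaf S C P"
  shows "functor_comp (elements D (functor_comp D P F)) (elements_proj C P) (elements_functor D P F)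
    = functor_comp (elements D (functor_comp D P F)) F (elements_proj D (functor_comp D P F))"
proof -
  let ?Q = "functor_comp D P F"
  interpret P: presheaf S C P by fact
  interpret Q: presheaf S D ?Q using assms by (rule presheaf_comp)
  have "cat_functor (elements D ?Q) C (functor_comp (elements D ?Q) F (elements_proj D ?Q))"
    using Q.cat_functor_proj F by (rule cat_functor_comp)
  then show ?thesis
    unfolding elements_functor_eq_pairing[OF assms]
    by (rule P.proj_pairing)
      (use cat_functor_elements_functor[OF assms] in \<open>simp add: elements_functor_eq_pairing[OF assms]\<close>)
qed

text \<open>An element of \<open>(P \<circ> F)(U x)\<close> is an element of \<open>P((F \<circ> U) x)\<close>, so \<open>\<Sigma>\<^sub>P F\<close> leaves sections alone. This
  gives the compatibility of \<open>\<Sigma>\<^sub>P\<close> with composition and the mediating functor of the pullback.\<close>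

lemma elements_functor_pairing:
  assumes F: "cat_functor D C F" and P: "presheaf S C P" and U: "cat_functor X D U"
    and K: "cat_functor X (elements D (functor_comp D P F)) (elements_pairing X U s)"
  shows "functor_comp X (elements_functor D P F) (elements_pairing X U s)
    = elements_pairing X (functor_comp X F U) s"
proof -
  let ?Q = "functor_comp D P F"
  interpret Q: presheaf S D ?Q using assms(1,2) by (rule presheaf_comp)
  interpret U: cat_functor X D U by fact
  interpret K: cat_functor X "elements D ?Q" "elements_pairing X U s" by fact
  show ?thesis
  proof (rule functor_map_eqI[of _ "Obj X" _ "Arr X"])
    fix x
    assume "x \<in> Obj X"
    then show "OMap (functor_comp X (elements_functor D P F) (elements_pairing X U s)) x
        = OMap (elements_pairing X (functor_comp X F U) s) x"
      using K.OMap_Obj[of x]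
      by (simp add: elements_functor_def Let_def functor_comp_opposite)
  next
    fix m
    assume "m \<in> Arr X"
    then show "AMap (functor_comp X (elements_functor D P F) (elements_pairing X U s)) m
        = AMap (elements_pairing X (functor_comp X F U) s) m"
      using K.AMap_Arr(1)[of m]
      by (simp add: elements_functor_def Let_def functor_comp_opposite U.source.Dom_Obj U.source.Cod_Obj)
  qed auto
qed

lemma elements_functor_id:
  assumes "presheaf S C P"
  shows "elements_functor C P (functor_id C) = functor_id (elements C P)"
proof -
  interpret presheaf S C P by fact
  have id: "cat_functor C C (functor_id C)" and idE: "cat_functor E E (functor_id E)"
    by (intro cat_functor_id category_axioms category_elements)+
  have P: "functor_comp C P (functor_id C) = P"
    using assms by (rule functor_comp_presheaf_id)
  have "elements_functor C P (functor_id C) = elements_pairing E pr usnd"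
    by (simp add: elements_functor_eq_pairing[OF id assms] P functor_comp_id_left[OF cat_functor_proj])
  also have "\<dots> = elements_pairing E (functor_comp E pr (functor_id E)) (\<lambda>e. usnd (OMap (functor_id E) e))"
    unfolding functor_comp_id_right[OF cat_functor_proj]
    using category.Dom_Obj[OF category_elements] category.Cod_Obj[OF category_elements]
    by (intro functor_map_eqI[of _ "Obj E" _ "Arr E"]) (simp_all del: elements_simps)
  also have "\<dots> = functor_id E"
    using pairing_eq[OF idE] by simp
  finally show ?thesis .
qed

lemma elements_functor_comp:
  assumes F: "cat_functor D C F" and P: "presheaf S C P" and G: "cat_functor B D G"
  shows "elements_functor B P (functor_comp B F G) =
    functor_comp (elements B (functor_comp B (functor_comp D P F) G))
      (elements_functor D P F) (elements_functor B (functor_comp D P F) G)"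
proof -
  let ?Q = "functor_comp D P F" let ?R = "functor_comp B ?Q G"
  interpret Q: presheaf S D ?Q using F P by (rule presheaf_comp)
  interpret R: presheaf S B ?R using G Q.presheaf_axioms by (rule presheaf_comp)
  have FG: "cat_functor B C (functor_comp B F G)"
    using G F by (rule cat_functor_comp)
  have R: "functor_comp B P (functor_comp B F G) = ?R"
    by (rule functor_comp_assoc[OF G, symmetric])
  let ?pr = "elements_proj B ?R"
  have "elements_functor B P (functor_comp B F G) =
      elements_pairing (elements B ?R) (functor_comp (elements B ?R) (functor_comp B F G) ?pr) usnd"
    by (simp only: elements_functor_eq_pairing[OF FG P] R)
  also have "\<dots> = elements_pairing (elements B ?R)
      (functor_comp (elements B ?R) F (functor_comp (elements B ?R) G ?pr)) usnd"
    by (simp only: functor_comp_assoc[OF R.cat_functor_proj])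
  also have "\<dots> = functor_comp (elements B ?R) (elements_functor D P F)
      (elements_pairing (elements B ?R) (functor_comp (elements B ?R) G ?pr) usnd)"
    using cat_functor_comp[OF R.cat_functor_proj G] cat_functor_elements_functor[OF G Q.presheaf_axioms]
    by (intro elements_functor_pairing[OF F P, symmetric])
      (simp_all only: elements_functor_eq_pairing[OF G Q.presheaf_axioms])
  finally show ?thesis
    by (simp only: elements_functor_eq_pairing[OF G Q.presheaf_axioms])
qed


section \<open>Computability transfers\<close>

lemma computability_transfer_id:
  assumes "base_of_computability C B"
  shows "computability_transfer C B C B (functor_id C)"
proof -
  interpret base_of_computability C B by fact
  interpret I: cat_functor C C "functor_id C" by (rule cat_functor_id) (rule category_axioms)
  show ?thesis
  proof unfold_locales
    show "AMap (functor_id C) i \<in> B (OMap (functor_id C) a)" if "a \<in> Obj C" "i \<in> B a" for a i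
      using that Base_Mon[OF that(1)] by (auto simp: functor_id_def Mon_def)
    show "pullback C (AMap (functor_id C) f) (AMap (functor_id C) j)
        (AMap (functor_id C) p) (AMap (functor_id C) q)" if "pullback C f j p q" for f j p q
      using that by (simp add: pullback_def hom_def)
  qed
qed

lemma computability_transfer_comp:
  assumes "computability_transfer C B D B' F" "computability_transfer D B' E B'' G"
  shows "computability_transfer C B E B'' (functor_comp C G F)"
proof -
  interpret F: computability_transfer C B D B' F by fact
  interpret G: computability_transfer D B' E B'' G by fact
  interpret GF: cat_functor C E "functor_comp C G F"
    by (rule cat_functor_comp) (rule F.cat_functor_axioms G.cat_functor_axioms)+
  show ?thesis
  proof unfold_locales
    fix a i
    assume "a \<in> Obj C" "i \<in> B a"
    moreover from this have "i \<in> Arr C"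
      using F.source.Base_Mon[of a] by (auto simp: Mon_def)
    ultimately show "AMap (functor_comp C G F) i \<in> B'' (OMap (functor_comp C G F) a)"
      by (simp add: F.transfer_base G.transfer_base F.OMap_Obj)
  next
    fix b j f s p q
    assume *: "b \<in> Obj C" "j \<in> B b" "f \<in> hom C s b" "pullback C f j p q"
    then have "f \<in> Arr C" "j \<in> Arr C" "p \<in> Arr C" "q \<in> Arr C"
      by (auto simp: pullback_def hom_def)
    moreover have "pullback E (AMap G (AMap F f)) (AMap G (AMap F j)) (AMap G (AMap F p)) (AMap G (AMap F q))"
      using * F.transfer_pullback[OF *] F.transfer_base[of b j]
      by (intro G.transfer_pullback[of "OMap F b"]) (auto intro: F.OMap_Obj F.AMap_hom)
    ultimately show "pullback E (AMap (functor_comp C G F) f) (AMap (functor_comp C G F) j)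
        (AMap (functor_comp C G F) p) (AMap (functor_comp C G F) q)"
      by simp
  qed
qed

lemma computability_transfer_cat_functor:
  "computability_transfer C B D B' F \<Longrightarrow> cat_functor C D F"
  by (rule computability_transfer.axioms)

abbreviation elements_base ::
    "'a ucat \<Rightarrow> ('a univ \<Rightarrow> 'a univ set) \<Rightarrow> 'a presheaf \<Rightarrow> 'a univ \<Rightarrow> 'a univ set" where
  "elements_base C B P \<equiv> preimage_base (elements C P) C (elements_proj C P) B"

lemma based_discrete_fibration_elements:
  assumes "base_of_computability C B" "presheaf S C P"
  shows "based_discrete_fibration (elements C P) C (elements_proj C P) B"
  using assms by (intro based_discrete_fibration.intro presheaf.discrete_fibration_proj)

text \<open>Over the base, \<open>\<Sigma>\<^sub>P F\<close> becomes \<open>F \<circ> p\<close>, a composite of transfers.\<close>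

lemma computability_transfer_elements_functor:
  assumes F: "computability_transfer D B' C B F" and P: "presheaf S C P"
  shows "computability_transfer (elements D (functor_comp D P F)) (elements_base D B' (functor_comp D P F))
    (elements C P) (elements_base C B P) (elements_functor D P F)"
proof -
  let ?Q = "functor_comp D P F"
  interpret F: computability_transfer D B' C B F by fact
  interpret Q: presheaf S D ?Q using F.cat_functor_axioms P by (rule presheaf_comp)
  interpret EP: based_discrete_fibration "elements C P" C "elements_proj C P" B
    using F.target.base_of_computability_axioms P by (rule based_discrete_fibration_elements)
  interpret EQ: based_discrete_fibration "elements D ?Q" D "elements_proj D ?Q" B'
    using F.source.base_of_computability_axioms Q.presheaf_axioms by (rule based_discrete_fibration_elements)
  show ?thesis
    using cat_functor_elements_functor[OF F.cat_functor_axioms P]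
      computability_transfer_comp[OF EQ.computability_transfer_proj F]
    by (intro EP.computability_transfer_into_lifted)
      (simp_all only: proj_elements_functor[OF F.cat_functor_axioms P])
qed

text \<open>From \<open>F \<circ> U = p \<circ> V\<close> it follows that \<open>V x = (F (U x), s x)\<close> for some \<open>s x \<in> P(F(U x))\<close>, and the
  mediating functor is \<open>x \<mapsto> (U x, s x)\<close>. It is forced, because the two conditions on it fix its
  first component and its section; it is a transfer because \<open>U\<close> is.\<close>

lemma elements_square_universal:
  fixes X D :: "'a ucat"
  assumes F: "computability_transfer D B' C B F" and P: "presheaf S C P"
    and U: "computability_transfer X B'' D B' U"
    and V: "computability_transfer X B'' (elements C P) (elements_base C B P) V"
    and eq: "functor_comp X F U = functor_comp X (elements_proj C P) V"
  shows "\<exists>!K. computability_transfer X B'' (elements D (functor_comp D P F))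
        (elements_base D B' (functor_comp D P F)) K
      \<and> functor_comp X (elements_proj D (functor_comp D P F)) K = U
      \<and> functor_comp X (elements_functor D P F) K = V"
proof -
  let ?Q = "functor_comp D P F"
  interpret P: presheaf S C P by fact
  interpret F: computability_transfer D B' C B F by fact
  interpret U: computability_transfer X B'' D B' U by fact
  interpret V: computability_transfer X B'' "elements C P" "elements_base C B P" V by fact
  interpret Q: presheaf S D ?Q using F.cat_functor_axioms P by (rule presheaf_comp)
  interpret EQ: based_discrete_fibration "elements D ?Q" D "elements_proj D ?Q" B'
    using F.source.base_of_computability_axioms Q.presheaf_axioms by (rule based_discrete_fibration_elements)
  define s where "s = (\<lambda>x. usnd (OMap V x))"
  have eqO: "ufst (OMap V x) = OMap F (OMap U x)" if "x \<in> Obj X" for x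
    using arg_cong[OF eq, of "\<lambda>H. OMap H x"] that V.OMap_Obj[OF that] by simp
  have eqA: "earr_base (AMap V m) = AMap F (AMap U m)" if "m \<in> Arr X" for m
    using arg_cong[OF eq, of "\<lambda>H. AMap H m"] that V.AMap_Arr(1)[OF that]
    by (simp add: elements_proj_def)
  let ?K = "elements_pairing X U s"
  have K: "cat_functor X (elements D ?Q) ?K"
  proof (rule Q.cat_functor_pairing[OF U.cat_functor_axioms])
    show "s x \<in> OMap ?Q (OMap U x)" if "x \<in> Obj X" for x
      using that P.cat_functor_elementsD(1)[OF V.cat_functor_axioms that]
      by (simp add: s_def eqO U.OMap_Obj)
    show "pact ?Q (AMap U m) (s (Cod X m)) = s (Dom X m)" if "m \<in> Arr X" for m
      using that P.cat_functor_elementsD(2)[OF V.cat_functor_axioms that]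
      by (simp add: s_def eqA pact_functor_comp U.AMap_Arr)
  qed
  have prK: "functor_comp X (elements_proj D ?Q) ?K = U"
    using U.cat_functor_axioms K by (rule Q.proj_pairing)
  have \<Sigma>K: "functor_comp X (elements_functor D P F) (elements_pairing X U t)
      = elements_pairing X (functor_comp X (elements_proj C P) V) t"
    if "cat_functor X (elements D ?Q) (elements_pairing X U t)" for t
    using elements_functor_pairing[OF F.cat_functor_axioms P U.cat_functor_axioms that] eq by simp
  show ?thesis
  proof (rule ex1I[of _ ?K], intro conjI)
    show "computability_transfer X B'' (elements D ?Q) (elements_base D B' ?Q) ?K"
      using K U by (intro EQ.computability_transfer_into_lifted) (simp_all only: prK)
    show "functor_comp X (elements_functor D P F) ?K = V"
      using \<Sigma>K[OF K] P.pairing_eq[OF V.cat_functor_axioms] by (simp add: s_def)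
  next
    fix L
    assume L: "computability_transfer X B'' (elements D ?Q) (elements_base D B' ?Q) L
      \<and> functor_comp X (elements_proj D ?Q) L = U \<and> functor_comp X (elements_functor D P F) L = V"
    then interpret L: computability_transfer X B'' "elements D ?Q" "elements_base D B' ?Q" L
      by simp
    define t where "t = (\<lambda>x. usnd (OMap L x))"
    have Leq: "L = elements_pairing X U t"
      using Q.pairing_eq[OF L.cat_functor_axioms] L by (simp add: t_def)
    then have Veq: "V = elements_pairing X (functor_comp X (elements_proj C P) V) t"
      using \<Sigma>K[of t] L L.cat_functor_axioms by simp
    have "s x = t x" if "x \<in> Obj X" for x
      using arg_cong[OF Veq, of "\<lambda>H. usnd (OMap H x)"] that by (simp add: s_def)
    then show "L = ?K"
      unfolding Leq by (intro functor_map_eqI[of _ "Obj X" _ "Arr X"])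
        (auto simp: U.source.Dom_Obj U.source.Cod_Obj)
  qed (rule prK)
qed


section \<open>The terminal category\<close>

definition point_category :: "'o \<Rightarrow> 'm \<Rightarrow> ('o, 'm) precategory" where
  "point_category o' m = \<lparr>Obj = {o'}, Arr = {m}, Dom = (\<lambda>_\<in>{m}. o'), Cod = (\<lambda>_\<in>{m}. o'),
     Ide = (\<lambda>_\<in>{o'}. m), Comp = (\<lambda>g f. if g = m \<and> f = m then m else undefined)\<rparr>"

lemma point_category_simps [simp]:
  "Obj (point_category o' m) = {o'}" "Arr (point_category o' m) = {m}"
  "Dom (point_category o' m) m = o'" "Cod (point_category o' m) m = o'"
  "Ide (point_category o' m) o' = m" "m \<cdot>\<^bsub>point_category o' m\<^esub> m = m"
  by (auto simp: point_category_def)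

lemma category_point: "category (point_category o' m)"
  by unfold_locales (auto simp: point_category_def hom_def)

lemma base_of_computability_point:
  "base_of_computability (point_category o' m) (\<lambda>_\<in>{o'}. {m})"
proof -
  interpret category "point_category o' m" by (rule category_point)
  show ?thesis
    by unfold_locales (auto simp: Mon_def pullback_def hom_def)
qed

text \<open>In a category with one arrow every square is a pullback, so the unique functor to it is a
  transfer.\<close>

lemma computability_transfer_to_point:
  assumes "base_of_computability C B"
  shows "\<exists>!F. computability_transfer C B (point_category o' m) (\<lambda>_\<in>{o'}. {m}) F"
proof (rule ex1I)
  interpret base_of_computability C B by fact
  interpret pt: base_of_computability "point_category o' m" "\<lambda>_\<in>{o'}. {m}"
    by (rule base_of_computability_point)
  let ?F = "\<lparr>OMap = (\<lambda>_\<in>Obj C. o'), AMap = (\<lambda>_\<in>Arr C. m)\<rparr>"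
  interpret F: cat_functor C "point_category o' m" ?F
    by unfold_locales (auto simp: hom_def Dom_Obj Cod_Obj Ide_Arr Comp_Arr)
  show "computability_transfer C B (point_category o' m) (\<lambda>_\<in>{o'}. {m}) ?F"
  proof unfold_locales
    show "AMap ?F i \<in> (\<lambda>_\<in>{o'}. {m}) (OMap ?F a)" if "a \<in> Obj C" "i \<in> B a" for a i
      using that Base_Mon[OF that(1)] by (auto simp: Mon_def)
    show "pullback (point_category o' m) (AMap ?F f) (AMap ?F j) (AMap ?F p) (AMap ?F q)"
      if "pullback C f j p q" for f j p q
      using that by (auto simp: pullback_def hom_def)
  qed
  fix G
  assume "computability_transfer C B (point_category o' m) (\<lambda>_\<in>{o'}. {m}) G"
  then interpret G: computability_transfer C B "point_category o' m" "\<lambda>_\<in>{o'}. {m}" G .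
  show "G = ?F"
    by (rule functor_map_eqI[of _ "Obj C" _ "Arr C"])
      (use G.OMap_Obj G.AMap_Arr(1) in \<open>auto simp: G.OMap_ext G.AMap_ext\<close>)
qed


section \<open>The type-category of categories with a base of computability\<close>

lemma CatBaseComp_simps:
  "(C, B) \<in> Obj CatBaseComp \<longleftrightarrow> base_of_computability C B"
  "((C, B), (D, B'), F) \<in> Arr CatBaseComp \<longleftrightarrow> computability_transfer C B D B' F"
  "T \<in> hom CatBaseComp (C, B) (D, B') \<longleftrightarrow>
    (\<exists>F. T = ((C, B), (D, B'), F) \<and> computability_transfer C B D B' F)"
  "base_of_computability C B \<Longrightarrow> Ide CatBaseComp (C, B) = ((C, B), (C, B), functor_id C)"
  "\<lbrakk>computability_transfer C B D B' F; computability_transfer D B' E B'' G\<rbrakk>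
    \<Longrightarrow> ((D, B'), (E, B''), G) \<cdot>\<^bsub>CatBaseComp\<^esub> ((C, B), (D, B'), F)
      = ((C, B), (E, B''), functor_comp C G F)"
  by (auto simp: CatBaseComp_def Let_def hom_def)

lemma computability_transfer_bases:
  assumes "computability_transfer C B D B' F"
  shows "base_of_computability C B" "base_of_computability D B'"
  using assms by (auto dest: computability_transfer.axioms)

lemma category_CatBaseComp: "category CatBaseComp"
proof unfold_locales
  show "Dom CatBaseComp \<in> Arr CatBaseComp \<rightarrow>\<^sub>E Obj CatBaseComp"
    "Cod CatBaseComp \<in> Arr CatBaseComp \<rightarrow>\<^sub>E Obj CatBaseComp"
    "Ide CatBaseComp \<in> extensional (Obj CatBaseComp)"
    by (auto simp: CatBaseComp_def Let_def dest: computability_transfer_bases)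
  show "g \<cdot>\<^bsub>CatBaseComp\<^esub> f = undefined"
    if "\<not> (g \<in> Arr CatBaseComp \<and> f \<in> Arr CatBaseComp \<and> Dom CatBaseComp g = Cod CatBaseComp f)" for g f
    using that by (auto simp: CatBaseComp_def Let_def)
  show "Ide CatBaseComp a \<in> hom CatBaseComp a a" if "a \<in> Obj CatBaseComp" for a
    using that by (cases a) (auto simp: CatBaseComp_simps computability_transfer_id)
next
  fix f and a b :: "'a based_cat"
  assume "f \<in> hom CatBaseComp a b"
  moreover obtain C B D B' where ab: "a = (C, B)" "b = (D, B')" by (cases a; cases b)
  ultimately obtain F where F: "f = ((C, B), (D, B'), F)" "computability_transfer C B D B' F"
    by (auto simp: CatBaseComp_simps)
  note bases = computability_transfer_bases[OF F(2)]
  show "f \<cdot>\<^bsub>CatBaseComp\<^esub> Ide CatBaseComp a = f" "Ide CatBaseComp b \<cdot>\<^bsub>CatBaseComp\<^esub> f = f"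
    unfolding ab F(1) using F(2) bases computability_transfer_id[OF bases(1)]
      computability_transfer_id[OF bases(2)] computability_transfer_cat_functor[OF F(2)]
    by (simp_all add: CatBaseComp_simps functor_comp_id_left functor_comp_id_right)
next
  fix f g h and a b c d :: "'a based_cat"
  assume f: "f \<in> hom CatBaseComp a b"
  assume g: "g \<in> hom CatBaseComp b c"
  show "g \<cdot>\<^bsub>CatBaseComp\<^esub> f \<in> hom CatBaseComp a c"
    using f g by (cases a; cases b; cases c) (auto simp: CatBaseComp_simps computability_transfer_comp)
  assume h: "h \<in> hom CatBaseComp c d"
  show "(h \<cdot>\<^bsub>CatBaseComp\<^esub> g) \<cdot>\<^bsub>CatBaseComp\<^esub> f = h \<cdot>\<^bsub>CatBaseComp\<^esub> (g \<cdot>\<^bsub>CatBaseComp\<^esub> f)"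
    using f g h
    by (cases a; cases b; cases c; cases d)
      (auto simp: CatBaseComp_simps computability_transfer_comp functor_comp_assoc[OF computability_transfer_cat_functor])
qed

lemma terminal_CatBaseComp:
  "terminal CatBaseComp (point_category t t, \<lambda>_\<in>{t}. {t})"
  unfolding terminal_def
proof (intro conjI ballI)
  show "(point_category t t, \<lambda>_\<in>{t}. {t}) \<in> Obj CatBaseComp"
    by (simp add: CatBaseComp_simps base_of_computability_point)
  fix a :: "'a based_cat"
  assume a: "a \<in> Obj CatBaseComp"
  obtain C B where CB: "a = (C, B)" by (cases a)
  with a computability_transfer_to_point[of C B t t]
  show "\<exists>!f. f \<in> hom CatBaseComp a (point_category t t, \<lambda>_\<in>{t}. {t})"
    by (auto simp: CatBaseComp_simps)
qed

lemma CBC_simps: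
  "CBC_fcomp P ((D, B), X, F) = functor_comp D P F"
  "CBC_Sigma (C, B) P = (elements C P, elements_base C B P)"
  "CBC_pr1 (C, B) P = ((elements C P, elements_base C B P), (C, B), elements_proj C P)"
  "CBC_Sigma_arr P ((D, B'), (C, B), F) =
    ((elements D (functor_comp D P F), elements_base D B' (functor_comp D P F)),
     (elements C P, elements_base C B P), elements_functor D P F)"
  by (auto simp: CBC_fcomp_def CBC_Sigma_def CBC_pr1_def CBC_Sigma_arr_def functor_comp_opposite)

lemma CBC_fHom_iff: "base_of_computability C B \<Longrightarrow> P \<in> CBC_fHom S (C, B) \<longleftrightarrow> presheaf S C P"
  by (simp add: CBC_fHom_def presheaves_iff base_of_computability.axioms)

lemma Sigma_square_pullback:
  assumes F: "computability_transfer D B' C B F" and P: "presheaf S C P"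
  shows "pullback CatBaseComp ((D, B'), (C, B), F) (CBC_pr1 (C, B) P)
    (CBC_pr1 (D, B') (functor_comp D P F)) (CBC_Sigma_arr P ((D, B'), (C, B), F))"
proof -
  let ?Q = "functor_comp D P F"
  note bases = computability_transfer_bases[OF F]
  have Q: "presheaf S D ?Q"
    using computability_transfer_cat_functor[OF F] P by (rule presheaf_comp)
  note prP = based_discrete_fibration.computability_transfer_proj[OF
      based_discrete_fibration_elements[OF bases(2) P]]
  note prQ = based_discrete_fibration.computability_transfer_proj[OF
      based_discrete_fibration_elements[OF bases(1) Q]]
  note \<Sigma>F = computability_transfer_elements_functor[OF F P]
  have dom: "Dom CatBaseComp T = fst T" "Cod CatBaseComp T = fst (snd T)" if "T \<in> Arr CatBaseComp"
    for T :: "'a transfer"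
    using that by (auto simp: CatBaseComp_def Let_def)
  have arr: "((D, B'), (C, B), F) \<in> Arr CatBaseComp" "CBC_pr1 (C, B) P \<in> Arr CatBaseComp"
    "CBC_pr1 (D, B') ?Q \<in> Arr CatBaseComp" "CBC_Sigma_arr P ((D, B'), (C, B), F) \<in> Arr CatBaseComp"
    using F prP prQ \<Sigma>F by (simp_all add: CBC_simps CatBaseComp_simps)
  show ?thesis
    unfolding pullback_def
  proof (intro conjI allI ballI impI)
    show "((D, B'), (C, B), F) \<cdot>\<^bsub>CatBaseComp\<^esub> CBC_pr1 (D, B') ?Q =
        CBC_pr1 (C, B) P \<cdot>\<^bsub>CatBaseComp\<^esub> CBC_Sigma_arr P ((D, B'), (C, B), F)"
      using F prP prQ \<Sigma>F proj_elements_functor[OF computability_transfer_cat_functor[OF F] P]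
      by (simp add: CBC_simps CatBaseComp_simps)
  next
    fix x u v
    assume u: "u \<in> hom CatBaseComp x (Dom CatBaseComp ((D, B'), (C, B), F))"
      and v: "v \<in> hom CatBaseComp x (Dom CatBaseComp (CBC_pr1 (C, B) P))"
      and uv: "((D, B'), (C, B), F) \<cdot>\<^bsub>CatBaseComp\<^esub> u = CBC_pr1 (C, B) P \<cdot>\<^bsub>CatBaseComp\<^esub> v"
    obtain X B'' where x: "x = (X, B'')" by (cases x)
    obtain U V where U: "u = ((X, B''), (D, B'), U)" "computability_transfer X B'' D B' U"
      and V: "v = ((X, B''), (elements C P, elements_base C B P), V)"
        "computability_transfer X B'' (elements C P) (elements_base C B P) V"
      using u v unfolding x dom(1)[OF arr(1)] dom(1)[OF arr(2)]
      by (auto simp: CBC_simps CatBaseComp_simps)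
    have "functor_comp X F U = functor_comp X (elements_proj C P) V"
      using uv U V F prP by (simp add: CBC_simps CatBaseComp_simps)
    from elements_square_universal[OF F P U(2) V(2) this]
    obtain K where K: "computability_transfer X B'' (elements D ?Q) (elements_base D B' ?Q) K"
        "functor_comp X (elements_proj D ?Q) K = U" "functor_comp X (elements_functor D P F) K = V"
      and unique: "\<And>L. \<lbrakk>computability_transfer X B'' (elements D ?Q) (elements_base D B' ?Q) L;
        functor_comp X (elements_proj D ?Q) L = U; functor_comp X (elements_functor D P F) L = V\<rbrakk>
        \<Longrightarrow> L = K"
      by (metis (no_types, lifting))
    show "\<exists>!k. k \<in> hom CatBaseComp x (Dom CatBaseComp (CBC_pr1 (D, B') ?Q))
        \<and> CBC_pr1 (D, B') ?Q \<cdot>\<^bsub>CatBaseComp\<^esub> k = u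
        \<and> CBC_Sigma_arr P ((D, B'), (C, B), F) \<cdot>\<^bsub>CatBaseComp\<^esub> k = v"
      unfolding dom(1)[OF arr(3)] unfolding x
    proof (rule ex1I[of _ "((X, B''), (elements D ?Q, elements_base D B' ?Q), K)"], goal_cases)
      case 1
      then show ?case
        using prQ \<Sigma>F U V K by (simp add: CBC_simps CatBaseComp_simps)
    next
      case (2 k)
      then obtain L where L: "k = ((X, B''), (elements D ?Q, elements_base D B' ?Q), L)"
          "computability_transfer X B'' (elements D ?Q) (elements_base D B' ?Q) L"
        by (auto simp: CBC_simps CatBaseComp_simps)
      with 2 have "functor_comp X (elements_proj D ?Q) L = U"
          "functor_comp X (elements_functor D P F) L = V"
        using prQ \<Sigma>F U V by (simp_all add: CBC_simps CatBaseComp_simps)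
      with L unique show ?case by simp
    qed
  qed (use arr in \<open>simp_all add: dom hom_def CBC_simps\<close>)
qed

theorem theorem6p8:
  fixes S :: "'a univ set set"
  shows "type_category (CatBaseComp :: ('a based_cat, 'a transfer) precategory)
           (CBC_fHom S) CBC_fcomp CBC_Sigma CBC_pr1 CBC_Sigma_arr"
proof -
  let ?K = "CatBaseComp :: ('a based_cat, 'a transfer) precategory"
  interpret category ?K by (rule category_CatBaseComp)
  have dom: "Dom ?K T = fst T" "Cod ?K T = fst (snd T)" if "T \<in> Arr ?K" for T
    using that by (auto simp: CatBaseComp_def Let_def)
  have fcomp: "CBC_fcomp l f \<in> CBC_fHom S b" if "l \<in> CBC_fHom S a" "f \<in> hom ?K b a" for a b l f
    using that
    by (cases a; cases b)
      (auto simp: CatBaseComp_simps CBC_simps CBC_fHom_iff computability_transfer_bases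
        intro: presheaf_comp[OF computability_transfer_cat_functor])
  have square: "pullback ?K f (CBC_pr1 a l) (CBC_pr1 b (CBC_fcomp l f)) (CBC_Sigma_arr l f)"
    if "l \<in> CBC_fHom S a" "f \<in> hom ?K b a" for a b l f
    using that
    by (cases a; cases b)
      (auto simp: CatBaseComp_simps CBC_simps(1) CBC_fHom_iff computability_transfer_bases
        intro: Sigma_square_pullback)
  have pr1: "CBC_pr1 a l \<in> hom ?K (CBC_Sigma a l) a" if "a \<in> Obj ?K" "l \<in> CBC_fHom S a" for a l
    using that
    by (cases a)
      (auto simp: CatBaseComp_simps CBC_simps CBC_fHom_iff
        intro: based_discrete_fibration.computability_transfer_proj based_discrete_fibration_elements)
  have fcomp_Ide: "CBC_fcomp l (Ide ?K a) = l" if "a \<in> Obj ?K" "l \<in> CBC_fHom S a" for a l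
    using that
    by (cases a) (auto simp: CatBaseComp_simps CBC_simps CBC_fHom_iff functor_comp_presheaf_id)
  show ?thesis
  proof unfold_locales
    show "CBC_fcomp l f \<in> CBC_fHom S c" if "l \<in> CBC_fHom S d" "f \<in> hom ?K c d" for c d l f
      using that by (rule fcomp)
    show "CBC_fcomp l (Ide ?K c) = l" if "c \<in> Obj ?K" "l \<in> CBC_fHom S c" for c l
      using that by (rule fcomp_Ide)
    show "CBC_fcomp l (g \<cdot>\<^bsub>?K\<^esub> f) = CBC_fcomp (CBC_fcomp l g) f"
      if "l \<in> CBC_fHom S e" "f \<in> hom ?K c d" "g \<in> hom ?K d e" for l c d e f g
      using that
      by (cases c; cases d; cases e)
        (auto simp: CatBaseComp_simps CBC_simps functor_comp_assoc computability_transfer_cat_functor)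
    show "CBC_pr1 a l \<in> hom ?K (CBC_Sigma a l) a" if "a \<in> Obj ?K" "l \<in> CBC_fHom S a" for a l
      using that by (rule pr1)
    show "CBC_Sigma a l \<in> Obj ?K" if "a \<in> Obj ?K" "l \<in> CBC_fHom S a" for a l
      using pr1[OF that] hom_Obj by blast
    show "pullback ?K f (CBC_pr1 a l) (CBC_pr1 b (CBC_fcomp l f)) (CBC_Sigma_arr l f)"
      if "l \<in> CBC_fHom S a" "f \<in> hom ?K b a" for a b l f
      using that by (rule square)
    show "CBC_Sigma_arr l f \<in> hom ?K (CBC_Sigma b (CBC_fcomp l f)) (CBC_Sigma a l)"
      if "a \<in> Obj ?K" "b \<in> Obj ?K" "l \<in> CBC_fHom S a" "f \<in> hom ?K b a" for a b l f
      using square[OF that(3,4)] pr1[OF that(1,3)] pr1[OF that(2) fcomp[OF that(3,4)]]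
      by (auto simp: pullback_def hom_def)
    show "CBC_Sigma_arr l (Ide ?K a) = Ide ?K (CBC_Sigma a l)"
      if "a \<in> Obj ?K" "l \<in> CBC_fHom S a" for a l
    proof -
      obtain C B where a: "a = (C, B)" by (cases a)
      with that have B: "base_of_computability C B" and P: "presheaf S C l"
        by (auto simp: CatBaseComp_simps CBC_fHom_iff)
      have "CBC_Sigma a l \<in> Obj ?K"
        using pr1[OF that] hom_Obj by blast
      then show ?thesis
        unfolding a using B P
        by (simp add: CatBaseComp_simps CBC_simps functor_comp_presheaf_id elements_functor_id)
    qed
    show "CBC_Sigma_arr l (f \<cdot>\<^bsub>?K\<^esub> g) = CBC_Sigma_arr l f \<cdot>\<^bsub>?K\<^esub> CBC_Sigma_arr (CBC_fcomp l f) g"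
      if l: "l \<in> CBC_fHom S a" and f: "f \<in> hom ?K b a" and g: "g \<in> hom ?K c b" for l a b c f g
    proof -
      obtain C B D B' X B'' where abc: "a = (C, B)" "b = (D, B')" "c = (X, B'')"
        by (cases a; cases b; cases c)
      obtain F G where F: "f = ((D, B'), (C, B), F)" "computability_transfer D B' C B F"
        and G: "g = ((X, B''), (D, B'), G)" "computability_transfer X B'' D B' G"
        using f g by (auto simp: abc CatBaseComp_simps)
      have P: "presheaf S C l"
        using l computability_transfer_bases[OF F(2)] by (simp add: abc CBC_fHom_iff)
      note fF = computability_transfer_cat_functor[OF F(2)]
      note fG = computability_transfer_cat_functor[OF G(2)]
      show ?thesis
        using F G computability_transfer_elements_functor[OF F(2) P]
          computability_transfer_elements_functor[OF G(2) presheaf_comp[OF fF P]]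
        by (simp add: CatBaseComp_simps CBC_simps elements_functor_comp[OF fF P fG]
            functor_comp_assoc[OF fG])
    qed
    show "\<exists>t. terminal ?K t"
      using terminal_CatBaseComp by blast
  qed
qed

end
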